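(* Let $2<p<\infty$, let $n,m$ be integers with $1\le m\le n-1$, let $L\subset\mathbb{R}^n$ be the unit ball of an $n$-dimensional subspace of $L_p$, and let $\mu$ be a measure with even continuous non-negative density in $\mathbb{R}^n$. Then $$\mu(L)\ \le\ n^{m/2-m/p}\, \frac{n}{n-m}\, c_{n,m}\, \max_{H\in Gr_{n-m}} \mu(L\cap H)\ |L|^{m/n},$$ where $c_{n,m}=|B_2^n|^{\frac{n-m}{n}}/|B_2^{n-m}|$.
   Context: Notation: $|\cdot|$ denotes volume of the appropriate dimension; $B_2^j$ is the unit Euclidean ball in $\mathbb{R}^j$; $Gr_{n-m}$ is the Grassmannian of $(n-m)$-dimensional linear subspaces of $\mathbb{R}^n$. Measures: if $\mu$ has even continuous non-negative density $f$ on $\mathbb{R}^n$, then $\mu(B)=\int_B f(x)\,dx$ for compact $B\subset\mathbb{R}^n$, and for $H\in Gr_{n-m}$, $\mu(L\cap H)=\int_{L\cap H} f$, the integral being with respect to $(n-m)$-dimensional Lebesgue measure on $H$. Subspaces of $L_p$: $L=\{x\in\mathbb{R}^n:\|x\|\le 1\}$ is the unit ball of an $n$-dimensional subspace of $L_p$ if $\|\cdot\|$ is a norm on $\mathbb{R}^n$ such that $(\mathbb{R}^n,\|\cdot\|)$ embeds isometrically in $L_p([0,1])$; equivalently, there is a finite Borel measure $\nu$ on $S^{n-1}$ with $\|x\|^p=\int_{S^{n-1}}|(x,\xi)|^p\,d\nu(\xi)$ for all $x\in\mathbb{R}^n$, where $(\cdot,\cdot)$ is the standard inner product. *)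

theory Defs
  imports "HOL-Analysis.Analysis"
begin

definition is_norm :: "(real ^ 'n \<Rightarrow> real) \<Rightarrow> bool" where
  "is_norm N \<longleftrightarrow>
     (\<forall>x. 0 \<le> N x) \<and> (\<forall>x. N x = 0 \<longleftrightarrow> x = 0) \<and>
     (\<forall>a x. N (a *\<^sub>R x) = \<bar>a\<bar> * N x) \<and>
     (\<forall>x y. N (x + y) \<le> N x + N y)"

definition Lp_functions :: "real \<Rightarrow> 'a measure \<Rightarrow> ('a \<Rightarrow> real) set" where
  "Lp_functions p M = {g \<in> borel_measurable M. integrable M (\<lambda>t. \<bar>g t\<bar> powr p)}"

definition Lp_norm :: "real \<Rightarrow> 'a measure \<Rightarrow> ('a \<Rightarrow> real) \<Rightarrow> real" where
  "Lp_norm p M g = (\<integral>t. \<bar>g t\<bar> powr p \<partial>M) powr (1 / p)"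

text \<open>Elements of \<open>L\<^sub>p\<close> are classes of functions modulo equality almost everywhere. An embedding
  is given here by representatives, so its linearity is required almost everywhere only.\<close>

definition embeds_isometrically_in_Lp01 :: "real \<Rightarrow> (real ^ 'n \<Rightarrow> real) \<Rightarrow> bool" where
  "embeds_isometrically_in_Lp01 p N \<longleftrightarrow>
     (\<exists>T :: real ^ 'n \<Rightarrow> real \<Rightarrow> real.
        (\<forall>x. T x \<in> Lp_functions p (lebesgue_on {0..1})) \<and>
        (\<forall>x y. AE t in lebesgue_on {0..1}. T (x + y) t = T x t + T y t) \<and>
        (\<forall>a x. AE t in lebesgue_on {0..1}. T (a *\<^sub>R x) t = a * T x t) \<and>
        (\<forall>x. Lp_norm p (lebesgue_on {0..1}) (T x) = N x))"

definition unit_ball_of_subspace_of_Lp :: "real \<Rightarrow> (real ^ 'n) set \<Rightarrow> bool" where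
  "unit_ball_of_subspace_of_Lp p L \<longleftrightarrow>
     (\<exists>N. is_norm N \<and> embeds_isometrically_in_Lp01 p N \<and> L = {x. N x \<le> 1})"

definition Grassmannian :: "nat \<Rightarrow> (real ^ 'n) set set" where
  "Grassmannian k = {H. subspace H \<and> dim H = k}"

definition orthonormal_basis_of :: "(real ^ 'n) set \<Rightarrow> (real ^ 'n) set \<Rightarrow> bool" where
  "orthonormal_basis_of H B \<longleftrightarrow> pairwise orthogonal B \<and> (\<forall>b\<in>B. norm b = 1) \<and> span B = H"

lemma orthonormal_basis_of_exists:
  assumes "subspace H"
  shows "\<exists>B. orthonormal_basis_of H B"
  using orthonormal_basis_subspace[OF assms] unfolding orthonormal_basis_of_def by metis

text \<open>The \<open>k\<close>-dimensional Lebesgue measure on a \<open>k\<close>-dimensional subspace, built as \<^const>\<open>lborel\<close>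
  is built from \<^const>\<open>Basis\<close>: the image of the product Lebesgue measure under orthonormal
  coordinates. By rotation invariance it does not depend on the basis chosen.\<close>

definition subspace_lborel :: "(real ^ 'n) set \<Rightarrow> (real ^ 'n) measure" where
  "subspace_lborel H =
     (let B = (SOME B. orthonormal_basis_of H B)
      in distr (Pi\<^sub>M B (\<lambda>_. lborel :: real measure)) borel (\<lambda>c. \<Sum>b\<in>B. c b *\<^sub>R b))"

definition mu :: "(real ^ 'n \<Rightarrow> real) \<Rightarrow> (real ^ 'n) set \<Rightarrow> real" where
  "mu f K = (LINT x:K|lborel. f x)"

definition mu_section :: "(real ^ 'n \<Rightarrow> real) \<Rightarrow> (real ^ 'n) set \<Rightarrow> (real ^ 'n) set \<Rightarrow> real" where
  "mu_section f L H = (LINT x:L \<inter> H|subspace_lborel H. f x)"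

text \<open>\<^const>\<open>unit_ball_vol\<close> is the volume of the Euclidean unit ball; see \<open>content_ball\<close>.\<close>

definition c_const :: "nat \<Rightarrow> nat \<Rightarrow> real" where
  "c_const n m =
     unit_ball_vol (real n) powr ((real n - real m) / real n) / unit_ball_vol (real (n - m))"

end

theory Submission
  imports Defs
begin

text \<open>
  Lewis' theorem: if \<open>A\<close> maximises \<open>\<bar>det A\<bar>\<close> for given \<open>\<integral> \<bar>A F\<bar>\<^sup>p\<close>, where \<open>\<parallel>x\<parallel>\<^sup>p = \<integral> \<bar>x \<bullet> F\<bar>\<^sup>p\<close>, then the
  first-order conditions say that the weight \<open>\<bar>A F\<bar> powr (p - 2)\<close> makes \<open>A F\<close> isotropic. Cauchy-Schwarz and
  Hoelder then give a Euclidean norm \<open>\<bar>B x\<bar>\<close> with \<open>\<bar>B x\<bar> \<le> \<parallel>x\<parallel> \<le> n powr (1/2 - 1/p) * \<bar>B x\<bar>\<close>, so \<open>L\<close> lies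
  between two homothetic ellipsoids.

  Since \<open>\<bar>B x\<bar> \<le> 1\<close> on \<open>L\<close>, \<open>\<mu>(L)\<close> is at most the integral of \<open>f x / \<bar>B x\<bar>\<^sup>m\<close> over \<open>L\<close>. Integrating over the
  random subspace spanned by \<open>n - m\<close> independent Gaussian vectors with density proportional to
  \<open>exp (- \<bar>B x\<bar>\<^sup>2 / 2)\<close> expresses \<open>c * \<integral> g x / \<bar>B x\<bar>\<^sup>m\<close> as an average of weighted section integrals of \<open>g\<close>.
  The weights and the constant \<open>c\<close> need not be computed: the same identity for the indicator of the Euclidean
  unit ball, all of whose sections have the same volume, gives their total mass. This leaves the integral of
  \<open>1 / \<bar>B x\<bar>\<^sup>m\<close> over the unit ball, which is largest, for given volume of the ellipsoid, when the ellipsoid is a ball.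
\<close>

section \<open>Lebesgue measure in coordinates of a subspace\<close>

text \<open>Two obstacles shape the development. \<open>subspace_lborel\<close> rests on an
  arbitrary choice of basis, so it is never computed with directly: uniqueness of
  translation-invariant measures identifies it, up to a factor, with the image of Lebesgue measure
  under any independent frame, and \<open>coord_ball_vol\<close> records this factor in place of a
  Gram determinant. Averaging over sections would ordinarily call for an invariant measure on the
  Grassmannian and for polar coordinates; Gaussian frames replace both. The maximum over sections
  must moreover be attained, although the indicator of L is discontinuous; upper semicontinuity on a
  compact set of orthonormal frames is enough for that. Origin of the constants: the inner
  ellipsoid, of radius n^(1/p - 1/2), bounds the volume of the outer one by that of L and costs
  n^(m/2 - m/p); the integral of |B x|^(-m) over the unit ball yields n/(n-m) and the numerator of
  \<open>c_const\<close>; the denominator is the common volume of the central sections of the unit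
  ball. The exponent p > 2 enters through the positive powers p - 2 in Cauchy-Schwarz and 1 - 2/p in
  Hoelder.\<close>

interpretation lborel_product: product_sigma_finite "\<lambda>_ :: 'i. lborel :: 'a::euclidean_space measure"
  by standard

lemma measurable_linear_combination [measurable]:
  fixes w :: "'i \<Rightarrow> 'a::euclidean_space"
  shows "(\<lambda>c. \<Sum>i\<in>I. c i *\<^sub>R w i) \<in> borel_measurable (Pi\<^sub>M I (\<lambda>_. lborel :: real measure))"
  by (intro borel_measurable_sum borel_measurable_scaleR) (auto intro: measurable_component_singleton)

lemma nn_integral_lborel_affine:
  fixes g :: "'a::euclidean_space \<Rightarrow> ennreal"
  assumes [measurable]: "g \<in> borel_measurable borel" and "c \<noteq> 0"
  shows "(\<integral>\<^sup>+x. g x \<partial>lborel) = ennreal (\<bar>c\<bar> ^ DIM('a)) * (\<integral>\<^sup>+x. g (t + c *\<^sub>R x) \<partial>lborel)"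
  by (subst lborel_affine[OF \<open>c \<noteq> 0\<close>, of t])
     (simp add: nn_integral_density nn_integral_distr nn_integral_cmult)

text \<open>Fubini peels off one coordinate at a time and the one-dimensional substitution does the
  rest. The map is restricted to \<open>I\<close> because the points of the product space are
  extensional functions.\<close>

lemma nn_integral_PiM_affine:
  fixes g :: "('i \<Rightarrow> real) \<Rightarrow> ennreal"
  assumes "finite I" "t \<noteq> 0" "g \<in> borel_measurable (Pi\<^sub>M I (\<lambda>_. lborel))"
  shows "(\<integral>\<^sup>+c. g c \<partial>Pi\<^sub>M I (\<lambda>_. lborel :: real measure)) =
    ennreal (\<bar>t\<bar> ^ card I) * (\<integral>\<^sup>+c. g (\<lambda>i\<in>I. a i + t * c i) \<partial>Pi\<^sub>M I (\<lambda>_. lborel))"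
  using assms(1,3)
proof (induction I arbitrary: g rule: finite_induct)
  case empty
  show ?case
    using lborel_product.nn_integral_empty[of "\<lambda>_ :: 'i \<Rightarrow> real. 1"]
    by (simp add: lborel_product.nn_integral_empty restrict_def)
next
  case (insert i I)
  note [measurable] = insert.prems
  have [measurable]: "(\<lambda>c. \<lambda>j\<in>J. a j + t * c j) \<in> measurable (Pi\<^sub>M J (\<lambda>_. lborel)) (Pi\<^sub>M J (\<lambda>_. lborel :: real measure))"
    for J
    by (rule measurable_restrict) auto
  have upd: "(\<lambda>j\<in>insert i I. a j + t * (x(i := y)) j) = (\<lambda>j\<in>I. a j + t * x j)(i := a i + t * y)" for x y
    using insert.hyps by (auto simp: restrict_def fun_eq_iff)
  have "(\<integral>\<^sup>+c. g c \<partial>Pi\<^sub>M (insert i I) (\<lambda>_. lborel :: real measure)) =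
      (\<integral>\<^sup>+x. \<integral>\<^sup>+y. g (x(i := y)) \<partial>lborel \<partial>Pi\<^sub>M I (\<lambda>_. lborel))"
    using insert by (simp add: lborel_product.product_nn_integral_insert)
  also have "\<dots> = ennreal (\<bar>t\<bar> ^ card I) * (\<integral>\<^sup>+x. \<integral>\<^sup>+y. g ((\<lambda>j\<in>I. a j + t * x j)(i := y)) \<partial>lborel \<partial>Pi\<^sub>M I (\<lambda>_. lborel))"
    by (rule insert.IH) measurable
  also have "(\<integral>\<^sup>+x. \<integral>\<^sup>+y. g ((\<lambda>j\<in>I. a j + t * x j)(i := y)) \<partial>lborel \<partial>Pi\<^sub>M I (\<lambda>_. lborel)) =
     (\<integral>\<^sup>+x. ennreal \<bar>t\<bar> * (\<integral>\<^sup>+y. g ((\<lambda>j\<in>I. a j + t * x j)(i := a i + t * y)) \<partial>lborel) \<partial>Pi\<^sub>M I (\<lambda>_. lborel))"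
  proof (rule nn_integral_cong)
    fix x assume x: "x \<in> space (Pi\<^sub>M I (\<lambda>_. lborel :: real measure))"
    have "(\<lambda>j\<in>I. a j + t * x j) \<in> space (Pi\<^sub>M I (\<lambda>_. lborel :: real measure))"
      by (auto simp: space_PiM)
    then have [measurable]: "(\<lambda>y. g ((\<lambda>j\<in>I. a j + t * x j)(i := y))) \<in> borel_measurable lborel"
      by measurable
    show "(\<integral>\<^sup>+y. g ((\<lambda>j\<in>I. a j + t * x j)(i := y)) \<partial>lborel) =
       ennreal \<bar>t\<bar> * (\<integral>\<^sup>+y. g ((\<lambda>j\<in>I. a j + t * x j)(i := a i + t * y)) \<partial>lborel)"
      by (rule nn_integral_real_affine[OF _ \<open>t \<noteq> 0\<close>]) simp
  qed
  also have "\<dots> = ennreal \<bar>t\<bar> * (\<integral>\<^sup>+x. \<integral>\<^sup>+y. g (\<lambda>j\<in>insert i I. a j + t * (x(i := y)) j) \<partial>lborel \<partial>Pi\<^sub>M I (\<lambda>_. lborel))"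
    unfolding upd by (subst nn_integral_cmult) (auto, measurable)
  also have "(\<integral>\<^sup>+x. \<integral>\<^sup>+y. g (\<lambda>j\<in>insert i I. a j + t * (x(i := y)) j) \<partial>lborel \<partial>Pi\<^sub>M I (\<lambda>_. lborel)) =
     (\<integral>\<^sup>+c. g (\<lambda>j\<in>insert i I. a j + t * c j) \<partial>Pi\<^sub>M (insert i I) (\<lambda>_. lborel :: real measure))"
    using insert.hyps by (subst lborel_product.product_nn_integral_insert[symmetric]) (auto intro!: measurable_compose[OF _ insert.prems])
  finally have "integral\<^sup>N (Pi\<^sub>M (insert i I) (\<lambda>_. lborel)) g = ennreal (\<bar>t\<bar> ^ card I) * (ennreal \<bar>t\<bar> *
      (\<integral>\<^sup>+c. g (\<lambda>j\<in>insert i I. a j + t * c j) \<partial>Pi\<^sub>M (insert i I) (\<lambda>_. lborel)))" .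
  moreover have "ennreal (\<bar>t\<bar> ^ card (insert i I)) = ennreal (\<bar>t\<bar> ^ card I) * ennreal \<bar>t\<bar>"
    using insert.hyps by (simp add: ennreal_mult'[symmetric] mult.commute)
  ultimately show ?case by (simp only: mult.assoc)
qed

text \<open>The Fubini argument behind the uniqueness of Haar measure.\<close>

lemma translation_invariant_unique:
  fixes M N :: "'a::euclidean_space measure"
  assumes "sigma_finite_measure M" "sigma_finite_measure N"
    and sets [measurable_cong]: "sets M = sets borel" "sets N = sets borel"
    and AE: "AE x in M. x \<in> H" "AE x in N. x \<in> H"
    and invM: "\<And>h x. h \<in> borel_measurable borel \<Longrightarrow> x \<in> H \<Longrightarrow> (\<integral>\<^sup>+y. h (x + y) \<partial>M) = (\<integral>\<^sup>+y. h y \<partial>M)"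
    and invN: "\<And>h x. h \<in> borel_measurable borel \<Longrightarrow> x \<in> H \<Longrightarrow> (\<integral>\<^sup>+y. h (x + y) \<partial>N) = (\<integral>\<^sup>+y. h y \<partial>N)"
    and [measurable]: "g \<in> borel_measurable borel" "h \<in> borel_measurable borel"
  shows "(\<integral>\<^sup>+x. g x \<partial>M) * (\<integral>\<^sup>+y. h y \<partial>N) = (\<integral>\<^sup>+y. g (- y) \<partial>N) * (\<integral>\<^sup>+x. h x \<partial>M)"
proof -
  interpret M: sigma_finite_measure M by fact
  interpret N: sigma_finite_measure N by fact
  interpret MN: pair_sigma_finite M N ..
  have "(\<integral>\<^sup>+x. g x \<partial>M) * (\<integral>\<^sup>+y. h y \<partial>N) = (\<integral>\<^sup>+x. \<integral>\<^sup>+y. g x * h y \<partial>N \<partial>M)"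
    by (simp add: nn_integral_multc nn_integral_cmult)
  \<comment> \<open>Inserting the shift in \<open>h\<close> couples the two variables. After
    exchanging the integrals, a shift by y moves it over to \<open>g\<close>, and a final shift by x
    turns g (x - y) into g (- y), which separates the variables again.\<close>
  also have "\<dots> = (\<integral>\<^sup>+x. \<integral>\<^sup>+y. g x * h (x + y) \<partial>N \<partial>M)"
    by (rule nn_integral_cong_AE, use AE(1) in eventually_elim) (simp add: nn_integral_cmult invN)
  also have "\<dots> = (\<integral>\<^sup>+y. \<integral>\<^sup>+x. g x * h (x + y) \<partial>M \<partial>N)"
    by (rule MN.Fubini'[symmetric]) measurable
  also have "\<dots> = (\<integral>\<^sup>+y. \<integral>\<^sup>+x. g (x - y) * h x \<partial>M \<partial>N)"
  proof (rule nn_integral_cong_AE, use AE(2) in eventually_elim)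
    fix y assume "y \<in> H"
    then show "(\<integral>\<^sup>+x. g x * h (x + y) \<partial>M) = (\<integral>\<^sup>+x. g (x - y) * h x \<partial>M)"
      using invM[of "\<lambda>x. g (x - y) * h x" y] by (simp add: add.commute)
  qed
  also have "\<dots> = (\<integral>\<^sup>+x. \<integral>\<^sup>+y. g (x - y) * h x \<partial>N \<partial>M)"
    by (rule MN.Fubini') measurable
  also have "\<dots> = (\<integral>\<^sup>+x. \<integral>\<^sup>+y. g (- y) * h x \<partial>N \<partial>M)"
  proof (rule nn_integral_cong_AE, use AE(1) in eventually_elim)
    fix x assume "x \<in> H"
    then show "(\<integral>\<^sup>+y. g (x - y) * h x \<partial>N) = (\<integral>\<^sup>+y. g (- y) * h x \<partial>N)"
      using invN[of "\<lambda>y. g (x - y) * h x" x] by simp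
  qed
  also have "\<dots> = (\<integral>\<^sup>+y. g (- y) \<partial>N) * (\<integral>\<^sup>+x. h x \<partial>M)"
    by (simp add: nn_integral_multc nn_integral_cmult)
  finally show ?thesis .
qed

section \<open>Volume distortion of linear coordinates\<close>

abbreviation coords :: "'i set \<Rightarrow> ('i \<Rightarrow> real) measure" where
  "coords I \<equiv> Pi\<^sub>M I (\<lambda>_. lborel)"

definition lin_comb :: "'i set \<Rightarrow> ('i \<Rightarrow> 'a::euclidean_space) \<Rightarrow> ('i \<Rightarrow> real) \<Rightarrow> 'a" where
  "lin_comb I w c = (\<Sum>i\<in>I. c i *\<^sub>R w i)"

text \<open>For independent vectors this is the volume of the Euclidean unit ball divided by the
  square root of their Gram determinant; for dependent vectors it is infinite. It thus serves both
  as the Jacobian of the frame and as a test of independence.\<close>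

definition coord_ball_vol :: "'i set \<Rightarrow> ('i \<Rightarrow> 'a::euclidean_space) \<Rightarrow> ennreal" where
  "coord_ball_vol I w = (\<integral>\<^sup>+c. indicator (cball 0 1) (lin_comb I w c) \<partial>coords I)"

lemma measurable_lin_comb [measurable]:
  "(\<lambda>c. lin_comb I w c) \<in> borel_measurable (coords I)"
  "lin_comb I w \<in> borel_measurable (coords I)"
  unfolding lin_comb_def by measurable

lemma cball_sets_borel [measurable]: "cball x r \<in> sets borel"
  by simp

lemma lin_comb_add: "lin_comb I w (\<lambda>i\<in>I. a i + t * c i) = lin_comb I w a + t *\<^sub>R lin_comb I w c"
  by (simp add: lin_comb_def scaleR_add_left sum.distrib scaleR_sum_right)

lemma lin_comb_in_span: "lin_comb I w c \<in> span (w ` I)"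
  unfolding lin_comb_def by (intro span_sum span_scale span_base) auto

lemma span_image_lin_comb:
  assumes "finite I" "x \<in> span (w ` I)"
  shows "\<exists>a. x = lin_comb I w a"
  using assms(2)
proof (induction rule: span_induct_alt)
  case base
  show ?case by (rule exI[of _ "\<lambda>_. 0"]) (simp add: lin_comb_def)
next
  case (step t x y)
  then obtain j a where j: "j \<in> I" "x = w j" and a: "y = lin_comb I w a" by auto
  have "t *\<^sub>R x + y = lin_comb I w (a(j := a j + t))"
    using assms(1) j unfolding a lin_comb_def
    by (simp add: sum.remove[of I j] algebra_simps)
  then show ?case by blast
qed

text \<open>Every vector of the span has some coordinate vector, unique or not, so translating by it
  is a shift in coordinate space, under which the product measure is invariant.\<close>

lemma nn_integral_lin_comb_shift:
  assumes "finite I" and [measurable]: "h \<in> borel_measurable borel" and "x \<in> span (w ` I)"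
  shows "(\<integral>\<^sup>+c. h (x + lin_comb I w c) \<partial>coords I) = (\<integral>\<^sup>+c. h (lin_comb I w c) \<partial>coords I)"
proof -
  obtain a where a: "x = lin_comb I w a" using span_image_lin_comb[OF assms(1,3)] by blast
  show ?thesis
    using nn_integral_PiM_affine[OF \<open>finite I\<close>, of 1 "\<lambda>c. h (lin_comb I w c)" a]
      lin_comb_add[of I w a 1]
    by (simp add: a)
qed

lemma nn_integral_lin_comb_cball:
  fixes w :: "'i \<Rightarrow> 'a::euclidean_space"
  assumes "finite I" "0 < r"
  shows "(\<integral>\<^sup>+c. indicator (cball 0 r) (lin_comb I w c) \<partial>coords I) = ennreal (r ^ card I) * coord_ball_vol I w"
proof -
  have "lin_comb I w (\<lambda>i\<in>I. r * c i) = r *\<^sub>R lin_comb I w c" for c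
    using lin_comb_add[of I w "\<lambda>_. 0" r c] by (simp add: lin_comb_def)
  moreover have "r *\<^sub>R x \<in> cball 0 r \<longleftrightarrow> x \<in> cball 0 1" for x :: 'a
    using \<open>0 < r\<close> by simp
  ultimately have "indicator (cball 0 r) (lin_comb I w (\<lambda>i\<in>I. r * c i)) = (indicator (cball 0 1) (lin_comb I w c) :: ennreal)" for c
    by (simp only: indicator_def)
  then show ?thesis
    using nn_integral_PiM_affine[OF \<open>finite I\<close>, of r "\<lambda>c. indicator (cball 0 r) (lin_comb I w c)" "\<lambda>_. 0"] \<open>0 < r\<close>
    by (simp add: coord_ball_vol_def)
qed

lemma norm_lin_comb_orthonormal:
  assumes "finite I" "pairwise (\<lambda>i j. orthogonal (w i) (w j)) I" "\<And>i. i \<in> I \<Longrightarrow> norm (w i) = 1"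
  shows "norm (lin_comb I w c) = sqrt (\<Sum>i\<in>I. (c i)\<^sup>2)"
proof -
  have "(norm (lin_comb I w c))\<^sup>2 = (\<Sum>i\<in>I. (norm (c i *\<^sub>R w i))\<^sup>2)"
    unfolding lin_comb_def using assms(1,2)
    by (intro norm_sum_Pythagorean) (auto simp: pairwise_def orthogonal_def)
  also have "\<dots> = (\<Sum>i\<in>I. (c i)\<^sup>2)"
    using assms(3) by (intro sum.cong) auto
  finally show ?thesis by (metis norm_ge_zero real_sqrt_unique)
qed

lemma coord_ball_vol_orthonormal:
  assumes "finite I" "pairwise (\<lambda>i j. orthogonal (w i) (w j)) I" "\<And>i. i \<in> I \<Longrightarrow> norm (w i) = 1"
  shows "coord_ball_vol I w = ennreal (unit_ball_vol (card I))"
proof -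
  note norm = norm_lin_comb_orthonormal[OF assms]
  have "coord_ball_vol I w = (\<integral>\<^sup>+c. indicator ({c. sqrt (\<Sum>i\<in>I. (c i)\<^sup>2) \<le> 1} \<inter> space (coords I)) c \<partial>coords I)"
    unfolding coord_ball_vol_def by (intro nn_integral_cong) (auto simp: indicator_def norm)
  also have "\<dots> = emeasure (coords I) ({c. sqrt (\<Sum>i\<in>I. (c i)\<^sup>2) \<le> 1} \<inter> space (coords I))"
  proof (rule nn_integral_indicator)
    have "{c. sqrt (\<Sum>i\<in>I. (c i)\<^sup>2) \<le> 1} \<inter> space (coords I) = {c \<in> space (coords I). lin_comb I w c \<in> cball 0 1}"
      by (auto simp: norm)
    also have "\<dots> \<in> sets (coords I)" by measurable
    finally show "{c. sqrt (\<Sum>i\<in>I. (c i)\<^sup>2) \<le> 1} \<inter> space (coords I) \<in> sets (coords I)" .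
  qed
  also have "\<dots> = ennreal (unit_ball_vol (card I))"
    using emeasure_cball_aux[OF \<open>finite I\<close>, of 1] by simp
  finally show ?thesis .
qed

text \<open>By homogeneity, finiteness for the unit ball passes to all balls, and those of integer
  radius exhaust the space. This is what makes Fubini available for the image measure.\<close>

lemma sigma_finite_distr_lin_comb:
  fixes w :: "'i \<Rightarrow> 'a::euclidean_space"
  assumes "finite I" "coord_ball_vol I w < \<infinity>"
  shows "sigma_finite_measure (distr (coords I) borel (lin_comb I w))"
proof
  let ?M = "distr (coords I) borel (lin_comb I w)"
  have fin: "emeasure ?M (cball 0 r) \<noteq> \<infinity>" if "0 < r" for r
  proof -
    have "emeasure ?M (cball 0 r) = (\<integral>\<^sup>+x. indicator (cball 0 r) x \<partial>?M)" by simp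
    also have "\<dots> = ennreal (r ^ card I) * coord_ball_vol I w"
      using assms that by (subst nn_integral_distr) (auto simp: nn_integral_lin_comb_cball)
    finally show ?thesis using assms(2) by (simp add: ennreal_mult_eq_top_iff)
  qed
  show "\<exists>A. countable A \<and> A \<subseteq> sets ?M \<and> \<Union>A = space ?M \<and> (\<forall>a\<in>A. emeasure ?M a \<noteq> \<infinity>)"
  proof (intro exI conjI)
    show "countable (range (\<lambda>n. cball 0 (real (Suc n)) :: 'a set))" by simp
    show "range (\<lambda>n. cball 0 (real (Suc n)) :: 'a set) \<subseteq> sets ?M" by auto
    show "\<Union>(range (\<lambda>n. cball 0 (real (Suc n)) :: 'a set)) = space ?M"
    proof -
      have "\<exists>n. norm x \<le> 1 + real n" for x :: 'a
        by (metis add.commute add_increasing2 le_add_same_cancel1 norm_ge_zero order_trans real_arch_simple zero_le_one)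
      then show ?thesis by auto
    qed
    show "\<forall>a\<in>range (\<lambda>n. cball 0 (real (Suc n)) :: 'a set). emeasure ?M a \<noteq> \<infinity>"
      using fin by auto
  qed
qed

text \<open>A linear relation makes the preimage of the unit ball invariant under a translation, so it
  contains infinitely many disjoint congruent pieces.\<close>

lemma coord_ball_vol_finite_imp_independent:
  assumes "finite I" "coord_ball_vol I w < \<infinity>" "lin_comb I w a = 0" "i \<in> I"
  shows "a i = 0"
proof (rule ccontr)
  assume "a i \<noteq> 0"
  \<comment> \<open>The preimage of the unit ball is cut into slabs of width 1 in the direction of
    coordinate \<open>i\<close>; half-open intervals keep the slabs disjoint.\<close>
  define S where "S j = (\<lambda>c. indicator (cball 0 1) (lin_comb I w c) * (indicator {j..<j+1} (c i) :: ennreal))" for j :: real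
  have [measurable]: "(\<lambda>c. c i) \<in> borel_measurable (coords I)"
    using measurable_component_singleton[OF \<open>i \<in> I\<close>, of "\<lambda>_. lborel :: real measure"] by simp
  have [measurable]: "S j \<in> borel_measurable (coords I)" for j
    unfolding S_def by measurable
  define v where "v = (\<integral>\<^sup>+c. S 0 c \<partial>coords I)"
  have shift: "(\<integral>\<^sup>+c. S j c \<partial>coords I) = v" for j
  proof -
    \<comment> \<open>This multiple of the relation \<open>a\<close> has i-th coordinate j: adding
      it moves the slab at 0 to the slab at j without changing the linear combination.\<close>
    have "lin_comb I w (\<lambda>k. j / a i * a k) = 0"
      using lin_comb_add[of I w "\<lambda>_. 0" "j / a i" a] assms(3)
      by (simp add: lin_comb_def)
    then have "S j (\<lambda>k\<in>I. j / a i * a k + 1 * c k) = S 0 c" for c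
      using \<open>a i \<noteq> 0\<close> \<open>i \<in> I\<close> lin_comb_add[of I w "\<lambda>k. j / a i * a k" 1 c]
      by (simp add: S_def indicator_def)
    then show ?thesis
      using nn_integral_PiM_affine[OF \<open>finite I\<close>, of 1 "S j" "\<lambda>k. j / a i * a k"] by (simp add: v_def)
  qed
  have "of_nat n * v \<le> coord_ball_vol I w" for n
  proof -
    have "of_nat n * v = (\<integral>\<^sup>+c. (\<Sum>j<n. S (real j) c) \<partial>coords I)"
      by (subst nn_integral_sum) (auto simp: shift)
    also have "\<dots> \<le> coord_ball_vol I w"
      unfolding coord_ball_vol_def
    proof (rule nn_integral_mono)
      fix c
      have "(\<Sum>j<n. indicator {real j..<real j + 1} (c i) :: ennreal) = indicator (\<Union>j<n. {real j..<real j + 1}) (c i)"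
        by (intro indicator_UN_disjoint[symmetric])
           (auto simp: disjoint_family_on_def)
      also have "\<dots> \<le> 1" by (simp add: indicator_def)
      finally have "indicator (cball 0 1) (lin_comb I w c) * (\<Sum>j<n. indicator {real j..<real j + 1} (c i) :: ennreal)
         \<le> indicator (cball 0 1) (lin_comb I w c) * 1" by (intro mult_left_mono) auto
      then show "(\<Sum>j<n. S (real j) c) \<le> indicator (cball 0 1) (lin_comb I w c)"
        by (simp add: S_def sum_distrib_left)
    qed
    finally show ?thesis .
  qed
  moreover have "v > 0"
  proof -
    \<comment> \<open>A cube of side 1/(2K) fits into the slab at 0: the norms of the vectors sum to
      K - 1, which keeps the combination in the unit ball, and the summand 1 keeps the side below
      1.\<close>
    define K where "K = 1 + (\<Sum>i\<in>I. norm (w i))"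
    have K: "K \<ge> 1" by (simp add: K_def sum_nonneg)
    have "0 < ennreal ((1 / (2 * K)) ^ card I)" using K by simp
    also have "\<dots> = emeasure (coords I) (Pi\<^sub>E I (\<lambda>_. {0..1 / (2 * K)}))"
      using \<open>finite I\<close> K by (subst lborel_product.emeasure_PiM) (auto simp: ennreal_power)
    also have "\<dots> = (\<integral>\<^sup>+c. indicator (Pi\<^sub>E I (\<lambda>_. {0..1 / (2 * K)})) c \<partial>coords I)"
      using \<open>finite I\<close> by (subst nn_integral_indicator) (auto intro!: sets_PiM_I_finite)
    also have "\<dots> \<le> v"
      unfolding v_def
    proof (rule nn_integral_mono)
      fix c
      show "indicator (Pi\<^sub>E I (\<lambda>_. {0..1 / (2 * K)})) c \<le> S 0 c"
      proof (cases "c \<in> Pi\<^sub>E I (\<lambda>_. {0..1 / (2 * K)})")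
        case True
        then have c: "0 \<le> c j" "c j \<le> 1 / (2 * K)" if "j \<in> I" for j using that by auto
        have "norm (lin_comb I w c) \<le> (\<Sum>j\<in>I. 1 / (2 * K) * norm (w j))"
          unfolding lin_comb_def
        proof (rule sum_norm_le)
          fix j assume "j \<in> I"
          then show "norm (c j *\<^sub>R w j) \<le> 1 / (2 * K) * norm (w j)"
            using c[of j] mult_right_mono[of "c j" "1 / (2 * K)" "norm (w j)"] by simp
        qed
        also have "\<dots> = (1 / (2 * K)) * (K - 1)"
          unfolding K_def by (simp add: sum_distrib_left)
        also have "\<dots> \<le> 1" using K by (simp add: field_simps)
        finally have "norm (lin_comb I w c) \<le> 1" .
        moreover have "1 / (2 * K) < 1" using K by simp
        then have "c i < 1" using c(2)[OF \<open>i \<in> I\<close>] by linarith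
        ultimately show ?thesis using c(1)[OF \<open>i \<in> I\<close>] by (simp add: S_def indicator_def)
      qed simp
    qed
    finally show ?thesis .
  qed
  ultimately have le: "of_nat n * v \<le> coord_ball_vol I w" for n by blast
  obtain V where V: "coord_ball_vol I w = ennreal V" "0 \<le> V"
    using assms(2) by (cases "coord_ball_vol I w") auto
  have "v < \<infinity>" using le[of 1] assms(2) by (simp add: order_le_less_trans)
  then obtain r where r: "v = ennreal r" "0 < r" using \<open>v > 0\<close> by (cases v) auto
  obtain n :: nat where "V / r < real n" using reals_Archimedean2 by blast
  then have "V < real n * r" using r by (simp add: field_simps)
  moreover have "ennreal (real n * r) \<le> ennreal V"
    using le[of n] r V by (simp add: ennreal_mult' ennreal_of_nat_eq_real_of_nat)
  ultimately show False using V r by (simp add: ennreal_le_iff)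
qed

lemma coord_ball_vol_finite_imp_dim:
  assumes "finite I" "coord_ball_vol I w < \<infinity>"
  shows "dim (span (w ` I)) = card I"
proof -
  note ind = coord_ball_vol_finite_imp_independent[OF assms]
  have inj: "inj_on w I"
  proof (rule inj_onI, rule ccontr)
    fix i j assume ij: "i \<in> I" "j \<in> I" "w i = w j" "i \<noteq> j"
    have "lin_comb I w (\<lambda>k. if k = i then 1 else if k = j then - 1 else 0) = (\<Sum>k\<in>{i,j}. (if k = i then 1 else if k = j then - 1 else 0) *\<^sub>R w k)"
      unfolding lin_comb_def using assms(1) ij by (intro sum.mono_neutral_right) auto
    also have "\<dots> = 0" using ij by simp
    finally show False using ind[of "\<lambda>k. if k = i then 1 else if k = j then - 1 else 0" i] ij by simp
  qed
  have "independent (w ` I)"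
  proof
    assume "dependent (w ` I)"
    then obtain u v where u: "(\<Sum>v\<in>w ` I. u v *\<^sub>R v) = 0" "v \<in> w ` I" "u v \<noteq> 0"
      using assms(1) dependent_finite[of "w ` I"] by auto
    then have "lin_comb I w (u \<circ> w) = 0"
      unfolding lin_comb_def by (simp add: sum.reindex[OF inj])
    then show False using ind[of "u \<circ> w"] u by auto
  qed
  then show ?thesis
    by (simp add: dim_eq_card_independent card_image[OF inj])
qed

lemma orthonormal_basis_card:
  fixes B :: "(real ^ 'n) set"
  assumes "orthonormal_basis_of H B"
  shows "finite B" "card B = dim H"
proof -
  have orth: "pairwise orthogonal B" and nrm: "\<And>b. b \<in> B \<Longrightarrow> norm b = 1" and span: "span B = H"
    using assms by (auto simp: orthonormal_basis_of_def)
  have "0 \<notin> B" using nrm by force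
  then have ind: "independent B" using orth by (rule pairwise_orthogonal_independent[rotated])
  then show "finite B" using independent_imp_finite by blast
  show "card B = dim H" using ind span by (metis dim_eq_card_independent dim_span)
qed

text \<open>The image of the coordinate measure and \<open>subspace_lborel\<close> both live on the
  span and are invariant under its translations, hence proportional; testing on the unit ball gives
  the ratio. This is the linear change of variables without determinants, and for orthonormal
  vectors it shows that the chosen basis is immaterial. The factor \<open>unit_ball_vol\<close>
  stays on the left to avoid a division in the extended reals.\<close>

lemma nn_integral_subspace_lborel:
  fixes w :: "'i \<Rightarrow> real ^ 'n"
  assumes "finite I" "coord_ball_vol I w < \<infinity>" and [measurable]: "h \<in> borel_measurable borel"
  shows "ennreal (unit_ball_vol (card I)) * (\<integral>\<^sup>+c. h (lin_comb I w c) \<partial>coords I) =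
    coord_ball_vol I w * (\<integral>\<^sup>+x. h x \<partial>subspace_lborel (span (w ` I)))"
proof -
  define H where "H = span (w ` I)"
  define B where "B = (SOME B. orthonormal_basis_of H B)"
  have B: "orthonormal_basis_of H B"
    unfolding B_def by (rule someI_ex) (simp add: orthonormal_basis_of_exists H_def)
  then have orth: "pairwise orthogonal B" and nrm: "\<And>b. b \<in> B \<Longrightarrow> norm b = 1" and span: "span B = H"
    by (auto simp: orthonormal_basis_of_def)
  have "finite B" "card B = card I"
    using orthonormal_basis_card[OF B] coord_ball_vol_finite_imp_dim[OF assms(1,2)] by (auto simp: H_def)
  define M where "M = distr (coords I) borel (lin_comb I w)"
  define N where "N = distr (coords B) borel (lin_comb B (\<lambda>b. b))"
  have N: "subspace_lborel H = N"
    unfolding subspace_lborel_def N_def Let_def B_def[symmetric] lin_comb_def ..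
  have vB: "coord_ball_vol B (\<lambda>b. b) = ennreal (unit_ball_vol (card I))"
    using coord_ball_vol_orthonormal[OF \<open>finite B\<close> _ nrm, of "\<lambda>b. b"] orth \<open>card B = card I\<close> by simp
  have "sigma_finite_measure M"
    unfolding M_def using assms by (intro sigma_finite_distr_lin_comb)
  moreover have "sigma_finite_measure N"
    unfolding N_def using \<open>finite B\<close> vB by (intro sigma_finite_distr_lin_comb) auto
  moreover have [measurable]: "H \<in> sets borel"
    by (simp add: H_def closed_subspace)
  moreover have "AE x in M. x \<in> H"
    unfolding M_def using lin_comb_in_span[of I w]
    by (subst AE_distr_iff) (auto simp: H_def)
  moreover have "AE x in N. x \<in> H"
    unfolding N_def using lin_comb_in_span[of B "\<lambda>b. b"] span
    by (subst AE_distr_iff) auto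
  moreover have "(\<integral>\<^sup>+y. h (x + y) \<partial>M) = (\<integral>\<^sup>+y. h y \<partial>M)" if [measurable]: "h \<in> borel_measurable borel" and "x \<in> H" for h x
    unfolding M_def using that assms(1) nn_integral_lin_comb_shift[of I h x w]
    by (simp add: nn_integral_distr H_def)
  moreover have "(\<integral>\<^sup>+y. h (x + y) \<partial>N) = (\<integral>\<^sup>+y. h y \<partial>N)" if [measurable]: "h \<in> borel_measurable borel" and "x \<in> H" for h x
    unfolding N_def using that \<open>finite B\<close> nn_integral_lin_comb_shift[of B h x "\<lambda>b. b"]
    by (simp add: nn_integral_distr span[symmetric])
  \<comment> \<open>The test set is the unit ball; its symmetry removes the reflection left by
    \<open>translation_invariant_unique\<close>.\<close>
  ultimately have "(\<integral>\<^sup>+x. indicator (cball 0 1) x \<partial>M) * (\<integral>\<^sup>+y. h y \<partial>N) =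
      (\<integral>\<^sup>+y. indicator (cball 0 1) (- y) \<partial>N) * (\<integral>\<^sup>+x. h x \<partial>M)"
    by (intro translation_invariant_unique[where H = H]) (auto simp: M_def N_def)
  moreover have "(\<integral>\<^sup>+x. indicator (cball 0 1) x \<partial>M) = coord_ball_vol I w"
    unfolding M_def coord_ball_vol_def by (subst nn_integral_distr) auto
  moreover have "(\<integral>\<^sup>+y. indicator (cball 0 1) (- y) \<partial>N) = coord_ball_vol B (\<lambda>b. b)"
    unfolding N_def coord_ball_vol_def by (subst nn_integral_distr) (auto simp: indicator_def)
  moreover have "(\<integral>\<^sup>+x. h x \<partial>M) = (\<integral>\<^sup>+c. h (lin_comb I w c) \<partial>coords I)"
    unfolding M_def by (subst nn_integral_distr) auto
  ultimately show ?thesis by (simp add: N vB flip: H_def)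
qed

section \<open>Gaussian averages over sections\<close>

lemma nn_integral_inverse_power_tail:
  assumes "0 < s" "1 \<le> q"
  shows "(\<integral>\<^sup>+r. ennreal (real q / r ^ (q + 1)) * indicator {s..} r \<partial>lborel) = ennreal (1 / s ^ q)"
proof -
  have "((\<lambda>r. - 1 / r ^ q) has_real_derivative real q / r ^ (q + 1)) (at r)" if "s \<le> r" for r
  proof -
    have "r \<noteq> 0" using that \<open>0 < s\<close> by simp
    then have "((\<lambda>r. - 1 / r ^ q) has_real_derivative (real q * r ^ (q - 1)) / (r ^ q * r ^ q)) (at r)"
      by (auto intro!: derivative_eq_intros)
    moreover have "r ^ q = r * r ^ (q - 1)" using \<open>1 \<le> q\<close> by (cases q) auto
    ultimately show ?thesis using \<open>r \<noteq> 0\<close> by (simp add: field_simps)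
  qed
  moreover have "((\<lambda>r::real. - 1 / r ^ q) \<longlongrightarrow> 0) at_top"
    using \<open>1 \<le> q\<close>
    by (intro tendsto_divide_0[OF tendsto_const] filterlim_at_top_imp_at_infinity filterlim_pow_at_top filterlim_ident) auto
  ultimately show ?thesis
    using \<open>0 < s\<close> by (subst nn_integral_FTC_atLeast[where F = "\<lambda>r. - 1 / r ^ q" and T = 0]) auto
qed

text \<open>Write 1/u^q as the integral of q/r^(q+1) over r from u to infinity and exchange the
  integrals. Only volumes of sublevel sets remain, which replaces polar coordinates
  throughout.\<close>

lemma (in sigma_finite_measure) nn_integral_inverse_power_layer_cake:
  assumes [measurable]: "u \<in> borel_measurable M" and pos: "AE x in M. 0 < u x" and "1 \<le> q"
  shows "(\<integral>\<^sup>+x. ennreal (1 / u x ^ q) \<partial>M) =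
    (\<integral>\<^sup>+r. ennreal (real q / r ^ (q + 1)) * emeasure M {x \<in> space M. u x \<le> r} * indicator {0<..} r \<partial>lborel)"
proof -
  interpret P: pair_sigma_finite M lborel ..
  have "(\<integral>\<^sup>+x. ennreal (1 / u x ^ q) \<partial>M) =
      (\<integral>\<^sup>+x. \<integral>\<^sup>+r. ennreal (real q / r ^ (q + 1)) * indicator {0<..} r * (if u x \<le> r then 1 else 0) \<partial>lborel \<partial>M)"
  proof (rule nn_integral_cong_AE, use pos in eventually_elim)
    fix x assume x: "0 < u x"
    have "(\<integral>\<^sup>+r. ennreal (real q / r ^ (q + 1)) * indicator {0<..} r * (if u x \<le> r then 1 else 0) \<partial>lborel)
       = (\<integral>\<^sup>+r. ennreal (real q / r ^ (q + 1)) * indicator {u x..} r \<partial>lborel)"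
      using x by (intro nn_integral_cong) (auto simp: indicator_def)
    then show "ennreal (1 / u x ^ q) =
        (\<integral>\<^sup>+r. ennreal (real q / r ^ (q + 1)) * indicator {0<..} r * (if u x \<le> r then 1 else 0) \<partial>lborel)"
      using nn_integral_inverse_power_tail[OF x \<open>1 \<le> q\<close>] by simp
  qed
  also have "\<dots> = (\<integral>\<^sup>+r. \<integral>\<^sup>+x. ennreal (real q / r ^ (q + 1)) * indicator {0<..} r * (if u x \<le> r then 1 else 0) \<partial>M \<partial>lborel)"
    by (rule P.Fubini'[symmetric]) measurable
  also have "\<dots> = (\<integral>\<^sup>+r. ennreal (real q / r ^ (q + 1)) * emeasure M {x \<in> space M. u x \<le> r} * indicator {0<..} r \<partial>lborel)"
  proof (rule nn_integral_cong)
    fix r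
    have "(\<integral>\<^sup>+x. (if u x \<le> r then 1 else 0) \<partial>M) = (\<integral>\<^sup>+x. indicator {x \<in> space M. u x \<le> r} x \<partial>M)"
      by (intro nn_integral_cong) (auto simp: indicator_def)
    also have "\<dots> = emeasure M {x \<in> space M. u x \<le> r}" by simp
    finally show "(\<integral>\<^sup>+x. ennreal (real q / r ^ (q + 1)) * indicator {0<..} r * (if u x \<le> r then 1 else 0) \<partial>M) =
       ennreal (real q / r ^ (q + 1)) * emeasure M {x \<in> space M. u x \<le> r} * indicator {0<..} r"
      by (subst nn_integral_cmult) (auto simp: mult_ac)
  qed
  finally show ?thesis .
qed

text \<open>Truncation by \<open>max 1\<close> removes the singularity, so only the growth of
  sublevel sets matters: since d < q, the layer integrand is at most q v / r^2. It is applied both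
  on the whole space and on the coordinate space of a frame.\<close>

lemma (in sigma_finite_measure) nn_integral_inverse_power_finite:
  assumes [measurable]: "u \<in> borel_measurable M" and "d < q"
    and growth: "\<And>r. 1 \<le> r \<Longrightarrow> emeasure M {x \<in> space M. u x \<le> r} \<le> ennreal (v * r ^ d)" and "0 \<le> v"
  shows "(\<integral>\<^sup>+x. ennreal (1 / (max 1 (u x)) ^ q) \<partial>M) < \<infinity>"
proof -
  have "(\<integral>\<^sup>+x. ennreal (1 / (max 1 (u x)) ^ q) \<partial>M) =
    (\<integral>\<^sup>+r. ennreal (real q / r ^ (q + 1)) * emeasure M {x \<in> space M. max 1 (u x) \<le> r} * indicator {0<..} r \<partial>lborel)"
    using \<open>d < q\<close> by (intro nn_integral_inverse_power_layer_cake) (auto intro!: AE_I2)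
  also have "\<dots> \<le> (\<integral>\<^sup>+r. ennreal (real q * v) * (ennreal (real 1 / r ^ (1 + 1)) * indicator {1..} r) \<partial>lborel)"
  proof (rule nn_integral_mono)
    fix r :: real
    show "ennreal (real q / r ^ (q + 1)) * emeasure M {x \<in> space M. max 1 (u x) \<le> r} * indicator {0<..} r
       \<le> ennreal (real q * v) * (ennreal (real 1 / r ^ (1 + 1)) * indicator {1..} r)"
    \<comment> \<open>For r < 1 the sublevel set is empty, because the truncated function is at
      least 1.\<close>
    proof (cases "1 \<le> r")
      case True
      have "ennreal (real q / r ^ (q + 1)) * emeasure M {x \<in> space M. max 1 (u x) \<le> r} \<le>
          ennreal (real q / r ^ (q + 1)) * ennreal (v * r ^ d)"
        using growth[OF True] True by (intro mult_left_mono) auto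
      also have "\<dots> = ennreal (real q / r ^ (q + 1) * (v * r ^ d))"
        using True \<open>0 \<le> v\<close> by (intro ennreal_mult[symmetric]) auto
      also have "\<dots> \<le> ennreal (real q * v * (1 / r ^ 2))"
      proof (rule ennreal_leI)
        have "r ^ (d + 2) \<le> r ^ (q + 1)" using True \<open>d < q\<close> by (intro power_increasing) auto
        then have "r ^ d / r ^ (q + 1) \<le> 1 / r ^ 2"
          using True by (simp add: field_simps power_add power2_eq_square)
        then have "real q * v * (r ^ d / r ^ (q + 1)) \<le> real q * v * (1 / r ^ 2)"
          using \<open>0 \<le> v\<close> by (intro mult_left_mono) auto
        then show "real q / r ^ (q + 1) * (v * r ^ d) \<le> real q * v * (1 / r ^ 2)"
          by (simp add: field_simps)
      qed
      also have "\<dots> = ennreal (real q * v) * ennreal (1 / r ^ 2)"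
        using True \<open>0 \<le> v\<close> by (intro ennreal_mult) auto
      finally show ?thesis using True by (simp add: power2_eq_square)
    qed (auto simp: not_le)
  qed
  also have "\<dots> = ennreal (real q * v)"
    using nn_integral_inverse_power_tail[of 1 1] by (subst nn_integral_cmult) auto
  finally show ?thesis by (simp add: le_less_trans)
qed

lemma power_le_fact_exp:
  fixes x :: real
  assumes "0 \<le> x"
  shows "x ^ q \<le> fact q * exp x"
proof -
  have "(\<Sum>n\<in>{q}. x ^ n /\<^sub>R fact n) \<le> exp x"
    unfolding exp_def using assms by (intro sum_le_suminf summable_exp_generic) auto
  then show ?thesis by (simp add: field_simps)
qed

text \<open>Only polynomial decay of the Gaussian is needed, so the constant is crude. One term of
  the exponential series bounds s^(2q), which dominates s^q only for s at least 1; smaller s are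
  trivial.\<close>

lemma power_exp_bound:
  fixes s :: real
  assumes "0 < s"
  shows "s ^ q * exp (- (s\<^sup>2 / 2)) \<le> 2 ^ q * fact q"
proof (cases "s \<le> 1")
  case True
  have "s ^ q * exp (- (s\<^sup>2 / 2)) \<le> 1 * 1"
    using True assms by (intro mult_mono power_le_one) auto
  also have "1 * 1 \<le> 2 ^ q * (fact q :: real)"
    by (rule mult_mono) (simp_all only: one_le_power one_le_numeral fact_ge_1 zero_le_one zero_le_power zero_le_numeral fact_ge_zero)
  finally show ?thesis .
next
  case False
  have "s ^ q \<le> s ^ (2 * q)" using False by (intro power_increasing) auto
  also have "\<dots> = 2 ^ q * (s\<^sup>2 / 2) ^ q" by (simp only: power_mult power_divide) simp
  also have "(s\<^sup>2 / 2) ^ q \<le> fact q * exp (s\<^sup>2 / 2)"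
    using power_le_fact_exp[of "s\<^sup>2 / 2" q] by simp
  finally have "s ^ q \<le> 2 ^ q * (fact q * exp (s\<^sup>2 / 2))" by simp
  then have "s ^ q * exp (- (s\<^sup>2 / 2)) \<le> 2 ^ q * (fact q * exp (s\<^sup>2 / 2)) * exp (- (s\<^sup>2 / 2))"
    by (rule mult_right_mono) simp
  also have "\<dots> = 2 ^ q * fact q"
    using exp_minus_inverse[of "s\<^sup>2 / 2"] by (simp only: mult.assoc mult_1_right)
  finally show ?thesis .
qed

section \<open>The Gaussian measure of an ellipsoid\<close>

locale injective_linear =
  fixes B :: "'a::euclidean_space \<Rightarrow> 'a"
  assumes linear_B: "linear B" and inj_B: "inj B"
begin

definition gauss :: "'a \<Rightarrow> ennreal" where
  "gauss x = ennreal (exp (- ((norm (B x))\<^sup>2 / 2)))"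

text \<open>Its value is (2 pi)^(n/2) / |det B|, with n the dimension; only its being positive and
  finite is ever used.\<close>

definition gauss_mass :: ennreal where
  "gauss_mass = (\<integral>\<^sup>+x. gauss x \<partial>lborel)"

definition gauss_measure :: "'a measure" where
  "gauss_measure = density lborel (\<lambda>x. gauss x / gauss_mass)"

lemma measurable_B [measurable]: "B \<in> borel_measurable borel"
  using linear_B by (intro borel_measurable_continuous_onI linear_continuous_on linear_conv_bounded_linear[THEN iffD1])

lemma measurable_gauss [measurable]: "gauss \<in> borel_measurable borel"
  unfolding gauss_def by measurable

lemma sets_gauss_measure [measurable_cong, simp]: "sets gauss_measure = sets borel"
  by (simp add: gauss_measure_def)

lemma norm_B_eq_0_iff [simp]: "norm (B x) = 0 \<longleftrightarrow> x = 0"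
  using linear_B inj_B by (simp add: linear_injective_0 linear_0) (metis linear_0)

lemma norm_B_pos: "x \<noteq> 0 \<Longrightarrow> 0 < norm (B x)"
  using norm_B_eq_0_iff[of x] by (simp del: norm_B_eq_0_iff norm_eq_zero add: less_le)

text \<open>This volume stands in for \<open>unit_ball_vol\<close> divided by |det B|. Homogeneity
  of the ellipsoid is all that is used of it, so no determinant of \<open>B\<close> appears.\<close>

definition body_vol :: real where
  "body_vol = measure lborel {x. norm (B x) \<le> 1}"

lemma bounded_body: "bounded {x. norm (B x) \<le> r}"
proof -
  obtain e where e: "e > 0" "\<And>x. e * norm x \<le> norm (B x)"
    using linear_inj_bounded_below_pos[OF linear_B inj_B] by (metis mult.commute)
  have "norm x \<le> r / e" if "norm (B x) \<le> r" for x
    using order_trans[OF e(2)[of x] that] e(1) by (simp add: field_simps)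
  then show ?thesis by (auto simp: bounded_iff)
qed

lemma body_measurable [measurable]: "{x. norm (B x) \<le> r} \<in> sets borel"
  by measurable

lemma emeasure_body:
  assumes "0 < r"
  shows "emeasure lborel {x. norm (B x) \<le> r} = ennreal (body_vol * r ^ DIM('a))"
proof -
  have "emeasure lborel {x. norm (B x) \<le> r} = (\<integral>\<^sup>+x. indicator {x. norm (B x) \<le> r} x \<partial>lborel)"
    by simp
  also have "\<dots> = ennreal (r ^ DIM('a)) * (\<integral>\<^sup>+x. indicator {x. norm (B x) \<le> r} (r *\<^sub>R x) \<partial>lborel)"
    using nn_integral_lborel_affine[of "indicator {x. norm (B x) \<le> r}" r 0] \<open>0 < r\<close> by simp
  also have "(\<lambda>x. indicator {x. norm (B x) \<le> r} (r *\<^sub>R x) :: ennreal) = indicator {x. norm (B x) \<le> 1}"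
    using \<open>0 < r\<close> linear_B by (auto simp: indicator_def linear_scale fun_eq_iff)
  also have "(\<integral>\<^sup>+x. indicator {x. norm (B x) \<le> 1} x \<partial>lborel) = ennreal body_vol"
    using bounded_body[of 1] emeasure_bounded_finite[of "{x. norm (B x) \<le> 1}"]
    by (simp add: body_vol_def emeasure_eq_ennreal_measure)
  finally show ?thesis
    using ennreal_mult[of body_vol "r ^ DIM('a)"] \<open>0 < r\<close> by (simp add: mult.commute body_vol_def)
qed

lemma body_vol_pos: "0 < body_vol"
proof -
  obtain K where K: "0 < K" "\<And>x. norm (B x) \<le> K * norm x"
    using linear_bounded_pos[OF linear_B] by blast
  have "cball 0 (1 / K) \<subseteq> {x. norm (B x) \<le> 1}"
  proof
    fix x :: 'a assume "x \<in> cball 0 (1 / K)"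
    then have "K * norm x \<le> 1" using K(1) by (simp add: field_simps)
    then show "x \<in> {x. norm (B x) \<le> 1}" using K(2)[of x] by simp
  qed
  then have "emeasure lborel (cball 0 (1 / K) :: 'a set) \<le> ennreal body_vol"
    using emeasure_mono[of "cball 0 (1 / K)" "{x. norm (B x) \<le> 1}" lborel] emeasure_body[of 1] by simp
  moreover have "0 < emeasure lborel (cball 0 (1 / K) :: 'a set)"
    using K(1) by (simp add: emeasure_cball)
  ultimately show ?thesis
    by (metis ennreal_less_zero_iff less_le_trans)
qed

lemma gauss_mass_finite: "gauss_mass < \<infinity>"
proof -
  \<comment> \<open>One more than the growth exponent in \<open>emeasure_body\<close>, as the strict
    inequality in \<open>nn_integral_inverse_power_finite\<close> requires.\<close>
  let ?q = "DIM('a) + 1"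
  have "gauss_mass \<le> (\<integral>\<^sup>+x. ennreal (2 ^ ?q * fact ?q) * ennreal (1 / (max 1 (norm (B x))) ^ ?q) \<partial>lborel)"
    unfolding gauss_mass_def
  proof (rule nn_integral_mono)
    fix x
    have "exp (- ((norm (B x))\<^sup>2 / 2)) \<le> (2 ^ ?q * fact ?q) * (1 / (max 1 (norm (B x))) ^ ?q)"
    proof (cases "1 \<le> norm (B x)")
      case True
      have "exp (- ((norm (B x))\<^sup>2 / 2)) \<le> 2 ^ ?q * fact ?q / norm (B x) ^ ?q"
      proof -
        have "0 < norm (B x)" using True by linarith
        then show ?thesis
          using power_exp_bound[of "norm (B x)" ?q] by (metis mult.commute pos_le_divide_eq zero_less_power)
      qed
      then show ?thesis using True by (simp add: max_def)
    next
      case False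
      have "exp (- ((norm (B x))\<^sup>2 / 2)) \<le> 1" by simp
      also have "\<dots> \<le> 2 ^ ?q * fact ?q"
        using mult_mono[of 1 "2 ^ ?q" 1 "fact ?q :: real"] one_le_power[of "2::real" ?q] fact_ge_1[of ?q, where 'a = real]
        by linarith
      finally show ?thesis using False by (simp add: max_def)
    qed
    then show "gauss x \<le> ennreal (2 ^ ?q * fact ?q) * ennreal (1 / (max 1 (norm (B x))) ^ ?q)"
      unfolding gauss_def by (subst ennreal_mult[symmetric]) (auto intro!: ennreal_leI)
  qed
  also have "\<dots> = ennreal (2 ^ ?q * fact ?q) * (\<integral>\<^sup>+x. ennreal (1 / (max 1 (norm (B x))) ^ ?q) \<partial>lborel)"
    by (rule nn_integral_cmult) measurable
  also have "\<dots> < \<infinity>"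
  proof -
    have "(\<integral>\<^sup>+x. ennreal (1 / (max 1 (norm (B x))) ^ ?q) \<partial>lborel) < \<infinity>"
      using body_vol_pos
      by (intro lborel.nn_integral_inverse_power_finite[where d = "DIM('a)" and v = body_vol])
         (auto simp: emeasure_body)
    then show ?thesis by (simp add: ennreal_mult_less_top)
  qed
  finally show ?thesis .
qed

lemma gauss_mass_pos: "0 < gauss_mass"
proof -
  have "\<not> (AE x in lborel. gauss x = 0)"
  proof
    assume "AE x in lborel. gauss x = 0"
    then have "AE x :: 'a in lborel. False" by eventually_elim (simp add: gauss_def)
    then show False by (simp add: eventually_False ae_filter_eq_bot_iff)
  qed
  then show ?thesis
    unfolding gauss_mass_def by (metis measurable_gauss measurable_lborel2 nn_integral_0_iff_AE not_gr_zero)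
qed

lemma nn_integral_gauss_measure:
  assumes [measurable]: "g \<in> borel_measurable borel"
  shows "(\<integral>\<^sup>+x. g x \<partial>gauss_measure) = (\<integral>\<^sup>+x. g x * gauss x \<partial>lborel) / gauss_mass"
proof -
  have "(\<integral>\<^sup>+x. g x \<partial>gauss_measure) = (\<integral>\<^sup>+x. (g x * gauss x) / gauss_mass \<partial>lborel)"
    unfolding gauss_measure_def
    by (subst nn_integral_density) (auto simp: ennreal_times_divide mult.commute)
  also have "\<dots> = (\<integral>\<^sup>+x. g x * gauss x \<partial>lborel) / gauss_mass"
    by (rule nn_integral_divide) measurable
  finally show ?thesis .
qed

lemma emeasure_gauss_measure_UNIV: "emeasure gauss_measure UNIV = 1"
proof -
  have "emeasure gauss_measure UNIV = (\<integral>\<^sup>+x. 1 \<partial>gauss_measure)"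
    by (simp add: gauss_measure_def)
  also have "\<dots> = gauss_mass / gauss_mass"
    by (subst nn_integral_gauss_measure) (auto simp: gauss_mass_def)
  also have "\<dots> = 1"
    using gauss_mass_finite gauss_mass_pos by (intro ennreal_divide_self) auto
  finally show ?thesis .
qed

sublocale gauss: finite_measure gauss_measure
  by standard (use emeasure_gauss_measure_UNIV in \<open>simp add: gauss_measure_def\<close>)

lemma space_gauss_measure [simp]: "space gauss_measure = UNIV"
  by (simp add: gauss_measure_def)

sublocale gauss_product: product_sigma_finite "\<lambda>_ :: 'i. gauss_measure"
  by standard

text \<open>Completing the square.\<close>

lemma gauss_product_rotate:
  assumes "a \<noteq> 0" and s: "s\<^sup>2 = a\<^sup>2 + b\<^sup>2"
  shows "gauss x * gauss (- (b / a) *\<^sub>R x + (s / a) *\<^sub>R y) =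
    gauss y * gauss (- (b / a) *\<^sub>R y + (s / a) *\<^sub>R x)"
proof -
  have sq: "(norm (B (u *\<^sub>R x + v *\<^sub>R y)))\<^sup>2 = u\<^sup>2 * (B x \<bullet> B x) + 2 * u * v * (B x \<bullet> B y) + v\<^sup>2 * (B y \<bullet> B y)" for u v x y
    using linear_B
    by (simp add: linear_add linear_scale power2_norm_eq_inner inner_add_left inner_add_right inner_commute[of "B y" "B x"] algebra_simps)
       (simp add: power2_eq_square)
  have "s\<^sup>2 / a\<^sup>2 = 1 + b\<^sup>2 / a\<^sup>2" using assms by (simp add: field_simps)
  then have coef: "(s / a)\<^sup>2 = 1 + (b / a)\<^sup>2" by (simp add: power_divide)
  have "(norm (B x))\<^sup>2 + (norm (B (- (b / a) *\<^sub>R x + (s / a) *\<^sub>R y)))\<^sup>2 =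
      (norm (B y))\<^sup>2 + (norm (B (- (b / a) *\<^sub>R y + (s / a) *\<^sub>R x)))\<^sup>2"
    unfolding sq coef by (simp add: power2_norm_eq_inner inner_commute algebra_simps)
  then show ?thesis
    unfolding gauss_def by (simp add: ennreal_mult'[symmetric] exp_add[symmetric] field_simps)
qed

text \<open>With s^2 = a^2 + b^2, substituting y = -(b/a) x + (s/a) u turns the argument of
  \<open>g\<close> into s u. By \<open>gauss_product_rotate\<close> the product density then becomes
  the Gaussian in u times a translated and rescaled Gaussian in x, which integrates out. The
  substitution is in the variable with coefficient a, whence a must not vanish.\<close>

lemma gauss_measure_convolution:
  assumes [measurable]: "g \<in> borel_measurable borel" and "a \<noteq> 0"
  shows "(\<integral>\<^sup>+x. \<integral>\<^sup>+y. g (a *\<^sub>R y + b *\<^sub>R x) \<partial>gauss_measure \<partial>gauss_measure) =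
    (\<integral>\<^sup>+x. g (sqrt (a\<^sup>2 + b\<^sup>2) *\<^sub>R x) \<partial>gauss_measure)"
proof -
  define s where "s = sqrt (a\<^sup>2 + b\<^sup>2)"
  define c where "c = ennreal (\<bar>s / a\<bar> ^ DIM('a))"
  have s2: "s\<^sup>2 = a\<^sup>2 + b\<^sup>2" by (simp add: s_def)
  have "s \<noteq> 0" using s2 \<open>a \<noteq> 0\<close> by (auto simp: sum_power2_eq_zero_iff)
  then have "s / a \<noteq> 0" using \<open>a \<noteq> 0\<close> by simp
  note aff = nn_integral_lborel_affine[OF _ this]
  have arg: "a *\<^sub>R (- (b / a) *\<^sub>R x + (s / a) *\<^sub>R u) + b *\<^sub>R x = s *\<^sub>R u" for x u :: 'a
    using \<open>a \<noteq> 0\<close> by (simp add: scaleR_diff_right)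
  have "(\<integral>\<^sup>+x. (\<integral>\<^sup>+y. g (a *\<^sub>R y + b *\<^sub>R x) * gauss y \<partial>lborel) * gauss x \<partial>lborel) =
     (\<integral>\<^sup>+x. c * (\<integral>\<^sup>+u. g (s *\<^sub>R u) * gauss (- (b / a) *\<^sub>R x + (s / a) *\<^sub>R u) \<partial>lborel) * gauss x \<partial>lborel)"
  proof (rule nn_integral_cong)
    fix x
    have "(\<integral>\<^sup>+y. g (a *\<^sub>R y + b *\<^sub>R x) * gauss y \<partial>lborel) =
       c * (\<integral>\<^sup>+u. g (s *\<^sub>R u) * gauss (- (b / a) *\<^sub>R x + (s / a) *\<^sub>R u) \<partial>lborel)"
      unfolding c_def by (subst aff[where t = "- (b / a) *\<^sub>R x"]) (auto simp only: arg, measurable)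
    then show "(\<integral>\<^sup>+y. g (a *\<^sub>R y + b *\<^sub>R x) * gauss y \<partial>lborel) * gauss x =
       c * (\<integral>\<^sup>+u. g (s *\<^sub>R u) * gauss (- (b / a) *\<^sub>R x + (s / a) *\<^sub>R u) \<partial>lborel) * gauss x" by simp
  qed
  also have "\<dots> = (\<integral>\<^sup>+x. \<integral>\<^sup>+u. c * g (s *\<^sub>R u) * (gauss x * gauss (- (b / a) *\<^sub>R x + (s / a) *\<^sub>R u)) \<partial>lborel \<partial>lborel)"
    by (subst nn_integral_cmult[symmetric] nn_integral_multc[symmetric], measurable)+
       (simp add: mult_ac)
  also have "\<dots> = (\<integral>\<^sup>+u. \<integral>\<^sup>+x. c * g (s *\<^sub>R u) * (gauss x * gauss (- (b / a) *\<^sub>R x + (s / a) *\<^sub>R u)) \<partial>lborel \<partial>lborel)"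
    by (rule lborel_pair.Fubini') measurable
  also have "\<dots> = (\<integral>\<^sup>+u. \<integral>\<^sup>+x. g (s *\<^sub>R u) * gauss u * (c * gauss (- (b / a) *\<^sub>R u + (s / a) *\<^sub>R x)) \<partial>lborel \<partial>lborel)"
    unfolding gauss_product_rotate[OF \<open>a \<noteq> 0\<close> s2] by (simp add: mult_ac)
  \<comment> \<open>The factor \<open>c\<close> is the Jacobian of the first substitution. The inner
    integral over x is the same affine substitution applied to the Gaussian, so it absorbs
    \<open>c\<close> and leaves the total mass.\<close>
  also have "\<dots> = (\<integral>\<^sup>+u. g (s *\<^sub>R u) * gauss u * gauss_mass \<partial>lborel)"
  proof (rule nn_integral_cong)
    fix u
    have "(\<integral>\<^sup>+x. c * gauss (- (b / a) *\<^sub>R u + (s / a) *\<^sub>R x) \<partial>lborel) = gauss_mass"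
      unfolding gauss_mass_def c_def by (subst (2) aff[where t = "- (b / a) *\<^sub>R u"]) (auto simp: nn_integral_cmult)
    then show "(\<integral>\<^sup>+x. g (s *\<^sub>R u) * gauss u * (c * gauss (- (b / a) *\<^sub>R u + (s / a) *\<^sub>R x)) \<partial>lborel) =
       g (s *\<^sub>R u) * gauss u * gauss_mass"
      by (subst nn_integral_cmult) auto
  qed
  also have "\<dots> = (\<integral>\<^sup>+u. g (s *\<^sub>R u) * gauss u \<partial>lborel) * gauss_mass"
    by (rule nn_integral_multc) measurable
  finally have main: "(\<integral>\<^sup>+x. (\<integral>\<^sup>+y. g (a *\<^sub>R y + b *\<^sub>R x) * gauss y \<partial>lborel) * gauss x \<partial>lborel) =
     (\<integral>\<^sup>+u. g (s *\<^sub>R u) * gauss u \<partial>lborel) * gauss_mass" .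
  have "(\<integral>\<^sup>+x. \<integral>\<^sup>+y. g (a *\<^sub>R y + b *\<^sub>R x) \<partial>gauss_measure \<partial>gauss_measure) =
     (\<integral>\<^sup>+x. ((\<integral>\<^sup>+y. g (a *\<^sub>R y + b *\<^sub>R x) * gauss y \<partial>lborel) / gauss_mass) * gauss x \<partial>lborel) / gauss_mass"
    by (simp add: nn_integral_gauss_measure)
  also have "(\<integral>\<^sup>+x. ((\<integral>\<^sup>+y. g (a *\<^sub>R y + b *\<^sub>R x) * gauss y \<partial>lborel) / gauss_mass) * gauss x \<partial>lborel) =
     (\<integral>\<^sup>+x. (\<integral>\<^sup>+y. g (a *\<^sub>R y + b *\<^sub>R x) * gauss y \<partial>lborel) * gauss x \<partial>lborel) / gauss_mass"
    by (subst nn_integral_divide[symmetric]) (auto simp: divide_ennreal_def mult_ac)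
  also have "\<dots> = (\<integral>\<^sup>+u. g (s *\<^sub>R u) * gauss u \<partial>lborel)"
    unfolding main using gauss_mass_pos gauss_mass_finite
    by (simp add: ennreal_mult_divide_eq)
  also have "\<dots> / gauss_mass = (\<integral>\<^sup>+x. g (s *\<^sub>R x) \<partial>gauss_measure)"
    by (subst nn_integral_gauss_measure) auto
  finally show ?thesis by (simp add: s_def)
qed

text \<open>Stability of the Gaussian law: each added index merges one more independent vector into
  the sum by \<open>gauss_measure_convolution\<close>. Here the coefficients z are fixed and the
  vectors are random.\<close>

lemma nn_integral_gauss_lin_comb:
  assumes "finite I" "g \<in> borel_measurable borel"
  shows "(\<integral>\<^sup>+G. g (lin_comb I G z) \<partial>Pi\<^sub>M I (\<lambda>_. gauss_measure)) =
    (\<integral>\<^sup>+x. g (sqrt (\<Sum>i\<in>I. (z i)\<^sup>2) *\<^sub>R x) \<partial>gauss_measure)"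
  using assms
proof (induction I arbitrary: g rule: finite_induct)
  case empty
  then show ?case
    using gauss_product.nn_integral_empty[of "\<lambda>_ :: 'b \<Rightarrow> 'a. g 0"]
    by (simp add: lin_comb_def emeasure_gauss_measure_UNIV del: nn_integral_const)
       (simp add: emeasure_gauss_measure_UNIV)
next
  case (insert i I)
  note [measurable] = insert.prems
  have [measurable]: "(\<lambda>G. lin_comb J G z) \<in> borel_measurable (Pi\<^sub>M J (\<lambda>_. gauss_measure))" for J
    unfolding lin_comb_def
    by (intro borel_measurable_sum borel_measurable_scaleR measurable_const)
       (auto simp: measurable_cong_sets[OF refl sets_gauss_measure[symmetric]])
  define s where "s = sqrt (\<Sum>j\<in>I. (z j)\<^sup>2)"
  have s: "sqrt (\<Sum>j\<in>insert i I. (z j)\<^sup>2) = sqrt ((z i)\<^sup>2 + s\<^sup>2)"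
    using insert.hyps by (simp add: s_def sum_nonneg)
  have upd: "lin_comb (insert i I) (x(i := y)) z = z i *\<^sub>R y + lin_comb I x z" for x y
    using insert.hyps by (auto simp: lin_comb_def intro!: sum.cong)
  have "(\<integral>\<^sup>+G. g (lin_comb (insert i I) G z) \<partial>Pi\<^sub>M (insert i I) (\<lambda>_. gauss_measure)) =
     (\<integral>\<^sup>+y. \<integral>\<^sup>+x. g (z i *\<^sub>R y + lin_comb I x z) \<partial>Pi\<^sub>M I (\<lambda>_. gauss_measure) \<partial>gauss_measure)"
    using insert.hyps by (subst gauss_product.product_nn_integral_insert_rev) (auto simp: upd)
  also have "\<dots> = (\<integral>\<^sup>+y. \<integral>\<^sup>+x. g (z i *\<^sub>R y + s *\<^sub>R x) \<partial>gauss_measure \<partial>gauss_measure)"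
    unfolding s_def by (intro nn_integral_cong insert.IH) measurable
  also have "\<dots> = (\<integral>\<^sup>+x. g (sqrt ((z i)\<^sup>2 + s\<^sup>2) *\<^sub>R x) \<partial>gauss_measure)"
  \<comment> \<open>A vanishing coefficient is excluded from
    \<open>gauss_measure_convolution\<close>, but then the new vector drops out. Otherwise the
    integrals are exchanged first, since that lemma wants the variable with nonzero coefficient
    inside.\<close>
  proof (cases "z i = 0")
    case True
    have "0 \<le> s" by (simp add: s_def sum_nonneg)
    then show ?thesis using True by (simp add: emeasure_gauss_measure_UNIV)
  next
    case False
    interpret pair_sigma_finite gauss_measure gauss_measure ..
    have "(\<integral>\<^sup>+y. \<integral>\<^sup>+x. g (z i *\<^sub>R y + s *\<^sub>R x) \<partial>gauss_measure \<partial>gauss_measure) =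
       (\<integral>\<^sup>+x. \<integral>\<^sup>+y. g (z i *\<^sub>R y + s *\<^sub>R x) \<partial>gauss_measure \<partial>gauss_measure)"
      by (rule Fubini') measurable
    then show ?thesis using gauss_measure_convolution[OF insert.prems False] by simp
  qed
  finally show ?case by (simp add: s)
qed

lemma measurable_lin_comb_pair:
  "(\<lambda>x. lin_comb I (fst x) (snd x)) \<in> borel_measurable (Pi\<^sub>M I (\<lambda>_. gauss_measure) \<Otimes>\<^sub>M coords I)"
proof -
  have *: "(\<lambda>x. fst x i) \<in> measurable (Pi\<^sub>M I (\<lambda>_. gauss_measure) \<Otimes>\<^sub>M coords I) gauss_measure" if "i \<in> I" for i
    using that by measurable
  have **: "(\<lambda>x. snd x i) \<in> borel_measurable (Pi\<^sub>M I (\<lambda>_. gauss_measure) \<Otimes>\<^sub>M coords I)" if "i \<in> I" for i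
    using that by measurable
  show ?thesis
    unfolding lin_comb_def
    using * ** by (intro borel_measurable_sum borel_measurable_scaleR)
      (auto simp: measurable_cong_sets[OF refl sets_gauss_measure])
qed

text \<open>The law of \<open>lin_comb I G z\<close> under Gaussian \<open>G\<close> depends on \<open>\<bar>z\<bar>\<close> only; integrating it over all
  \<open>z\<close> produces a homogeneous density of degree \<open>card I - DIM('a)\<close>. The value of the constant is irrelevant.\<close>

lemma nn_integral_gauss_sections:
  fixes I :: "'i set"
  assumes "finite I" "I \<noteq> {}" "card I + m = DIM('a)" "1 \<le> m"
  obtains c where "0 < c" "c < \<infinity>" and
    "\<And>g. g \<in> borel_measurable borel \<Longrightarrow>
      (\<integral>\<^sup>+G. \<integral>\<^sup>+z. g (lin_comb I G z) \<partial>coords I \<partial>Pi\<^sub>M I (\<lambda>_. gauss_measure)) =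
      c * (\<integral>\<^sup>+y. g y * ennreal (1 / norm (B y) ^ m) \<partial>lborel)"
proof -
  define \<rho> where "\<rho> z = sqrt (\<Sum>i\<in>I. (z i)\<^sup>2)" for z :: "'i \<Rightarrow> real"
  \<comment> \<open>Up to the factor \<open>gauss_mass\<close>, this is the density at y of \<rho> z
    times a Gaussian vector, with s standing for |B y|.\<close>
  define ker where "ker s z = ennreal (1 / \<rho> z ^ DIM('a) * exp (- ((s / \<rho> z)\<^sup>2 / 2)))" for s z
  have [measurable]: "\<rho> \<in> borel_measurable (coords I)"
    unfolding \<rho>_def by measurable
  have [measurable]: "(\<lambda>(s, z). ker s z) \<in> borel_measurable (borel \<Otimes>\<^sub>M coords I)"
    unfolding ker_def by measurable
  have [measurable]: "(\<lambda>s. ker s z) \<in> borel_measurable borel" for z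
    unfolding ker_def by measurable
  have \<rho>_nonneg: "0 \<le> \<rho> z" for z by (simp add: \<rho>_def sum_nonneg)
  interpret I: sigma_finite_measure "coords I"
    using \<open>finite I\<close> by (rule lborel_product.sigma_finite)
  interpret G: sigma_finite_measure "Pi\<^sub>M I (\<lambda>_. gauss_measure)"
    using \<open>finite I\<close> by (rule gauss_product.sigma_finite)
  interpret IL: pair_sigma_finite "coords I" lborel ..
  interpret GI: pair_sigma_finite "Pi\<^sub>M I (\<lambda>_. gauss_measure)" "coords I" ..
  have \<rho>_vol: "emeasure (coords I) {z \<in> space (coords I). \<rho> z \<le> r} = ennreal (unit_ball_vol (card I) * r ^ card I)"
    if "0 < r" for r
    using emeasure_cball_aux[OF \<open>finite I\<close> that] unfolding \<rho>_def by (simp add: Collect_conj_eq Int_commute)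
  \<comment> \<open>The kernel is meaningful only where \<rho> is positive. Its zero set is the
    origin of coordinate space, a null set because \<open>I\<close> is nonempty.\<close>
  have \<rho>_pos: "AE z in coords I. 0 < \<rho> z"
  proof (rule AE_I)
    have "emeasure (coords I) (Pi\<^sub>E I (\<lambda>_. {0})) = 0"
      using \<open>finite I\<close> \<open>I \<noteq> {}\<close> by (subst lborel_product.emeasure_PiM) auto
    then show "emeasure (coords I) (Pi\<^sub>E I (\<lambda>_. {0})) = 0" .
    show "Pi\<^sub>E I (\<lambda>_. {0}) \<in> sets (coords I)"
      using \<open>finite I\<close> by (intro sets_PiM_I_finite) auto
    show "{z \<in> space (coords I). \<not> 0 < \<rho> z} \<subseteq> Pi\<^sub>E I (\<lambda>_. {0})"
    proof
      fix z assume z: "z \<in> {z \<in> space (coords I). \<not> 0 < \<rho> z}"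
      then have "(\<Sum>i\<in>I. (z i)\<^sup>2) = 0"
        using \<rho>_nonneg[of z] by (simp add: \<rho>_def not_less)
      then have "\<forall>i\<in>I. z i = 0"
        using \<open>finite I\<close> by (simp add: sum_nonneg_eq_0_iff)
      with z show "z \<in> Pi\<^sub>E I (\<lambda>_. {0})"
      by (intro PiE_I) (auto simp: space_PiM PiE_iff extensional_def)
    qed
  qed
  \<comment> \<open>The value of the averaged density where |B y| = 1; homogeneity will supply all
    other y.\<close>
  define c where "c = (\<integral>\<^sup>+z. ker 1 z \<partial>coords I) / gauss_mass"
  have "(\<integral>\<^sup>+z. ker 1 z \<partial>coords I) < \<infinity>"
  proof -
    \<comment> \<open>Near 0 the exponential beats the pole, by \<open>power_exp_bound\<close> at 1
      / \<rho> z. At infinity the power \<rho>^(-n), with n the dimension, is integrable because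
      \<open>card I\<close> is smaller than n, that is, because m is at least 1.\<close>
    let ?q = "DIM('a)"
    have "(\<integral>\<^sup>+z. ker 1 z \<partial>coords I) \<le> (\<integral>\<^sup>+z. ennreal (2 ^ ?q * fact ?q) * ennreal (1 / (max 1 (\<rho> z)) ^ ?q) \<partial>coords I)"
    proof (rule nn_integral_mono_AE, use \<rho>_pos in eventually_elim)
      fix z assume z: "0 < \<rho> z"
      have "1 / \<rho> z ^ ?q * exp (- ((1 / \<rho> z)\<^sup>2 / 2)) \<le> 2 ^ ?q * fact ?q * (1 / (max 1 (\<rho> z)) ^ ?q)"
      proof (cases "1 \<le> \<rho> z")
        case True
        have "exp (- ((1 / \<rho> z)\<^sup>2 / 2)) \<le> 1" by simp
        also have "\<dots> \<le> 2 ^ ?q * fact ?q"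
          using mult_mono[of 1 "2 ^ ?q" 1 "fact ?q :: real"] one_le_power[of "2::real" ?q] fact_ge_1[of ?q, where 'a = real]
          by linarith
        finally have "1 / \<rho> z ^ ?q * exp (- ((1 / \<rho> z)\<^sup>2 / 2)) \<le> 1 / \<rho> z ^ ?q * (2 ^ ?q * fact ?q)"
          using z by (intro mult_left_mono) auto
        then show ?thesis using True by (simp add: max_def mult.commute)
      next
        case False
        then show ?thesis
          using power_exp_bound[of "1 / \<rho> z" ?q] z by (simp add: power_one_over max_def)
      qed
      then show "ker 1 z \<le> ennreal (2 ^ ?q * fact ?q) * ennreal (1 / (max 1 (\<rho> z)) ^ ?q)"
        unfolding ker_def by (subst ennreal_mult[symmetric]) (auto intro!: ennreal_leI)
    qed
    also have "\<dots> = ennreal (2 ^ ?q * fact ?q) * (\<integral>\<^sup>+z. ennreal (1 / (max 1 (\<rho> z)) ^ ?q) \<partial>coords I)"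
      by (rule nn_integral_cmult) measurable
    also have "\<dots> < \<infinity>"
    proof -
      have "(\<integral>\<^sup>+z. ennreal (1 / (max 1 (\<rho> z)) ^ ?q) \<partial>coords I) < \<infinity>"
        using assms
        by (intro I.nn_integral_inverse_power_finite[where d = "card I" and v = "unit_ball_vol (card I)"])
           (auto simp: \<rho>_vol)
      then show ?thesis by (simp add: ennreal_mult_less_top)
    qed
    finally show ?thesis .
  qed
  then have "c < \<infinity>"
    unfolding c_def using gauss_mass_pos
    by (auto simp: divide_ennreal_def ennreal_mult_less_top  less_top[symmetric] ennreal_mult_eq_top_iff)
  moreover have "0 < c"
  proof -
    have "\<not> (AE z in coords I. ker 1 z = 0)"
    proof
      assume "AE z in coords I. ker 1 z = 0"
      then have "AE z in coords I. False"
        using \<rho>_pos by eventually_elim (simp add: ker_def)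
      then have "emeasure (coords I) (space (coords I)) = 0"
        by (simp add: eventually_False ae_filter_eq_bot_iff)
      then have "emeasure (coords I) {z \<in> space (coords I). \<rho> z \<le> 1} = 0"
        by (metis (no_types, lifting) emeasure_space order_antisym zero_le)
      then show False using \<rho>_vol[of 1] unit_ball_vol_pos[of "real (card I)"] by simp
    qed
    then have "(\<integral>\<^sup>+z. ker 1 z \<partial>coords I) \<noteq> 0"
      by (subst nn_integral_0_iff_AE) auto
    then show ?thesis
      unfolding c_def using gauss_mass_finite by (simp add: ennreal_zero_less_divide zero_less_iff_neq_zero)
  qed
  moreover have "(\<integral>\<^sup>+G. \<integral>\<^sup>+z. g (lin_comb I G z) \<partial>coords I \<partial>Pi\<^sub>M I (\<lambda>_. gauss_measure)) =
      c * (\<integral>\<^sup>+y. g y * ennreal (1 / norm (B y) ^ m) \<partial>lborel)"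
    if [measurable]: "g \<in> borel_measurable borel" for g
  proof -
    note [measurable] = measurable_lin_comb_pair[of I]
    have "(\<integral>\<^sup>+G. \<integral>\<^sup>+z. g (lin_comb I G z) \<partial>coords I \<partial>Pi\<^sub>M I (\<lambda>_. gauss_measure)) =
        (\<integral>\<^sup>+z. \<integral>\<^sup>+G. g (lin_comb I G z) \<partial>Pi\<^sub>M I (\<lambda>_. gauss_measure) \<partial>coords I)"
      by (rule GI.Fubini'[symmetric]) measurable
    also have "\<dots> = (\<integral>\<^sup>+z. \<integral>\<^sup>+x. g (\<rho> z *\<^sub>R x) \<partial>gauss_measure \<partial>coords I)"
      unfolding \<rho>_def using \<open>finite I\<close> by (simp add: nn_integral_gauss_lin_comb)
    also have "\<dots> = (\<integral>\<^sup>+z. \<integral>\<^sup>+y. g y * ker (norm (B y)) z / gauss_mass \<partial>lborel \<partial>coords I)"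
    proof (rule nn_integral_cong_AE, use \<rho>_pos in eventually_elim)
      fix z assume z: "0 < \<rho> z"
      have ker: "g y * ker (norm (B y)) z = ennreal (1 / \<rho> z ^ DIM('a)) * (g y * gauss ((1 / \<rho> z) *\<^sub>R y))" for y
        using z linear_B unfolding ker_def gauss_def
        by (simp add: linear_scale mult.left_commute[of "ennreal (1 / \<rho> z ^ DIM('a))"] ennreal_mult'[symmetric])
      have "(\<integral>\<^sup>+y. g y * ker (norm (B y)) z \<partial>lborel) =
         ennreal (1 / \<rho> z ^ DIM('a)) * (\<integral>\<^sup>+y. g y * gauss ((1 / \<rho> z) *\<^sub>R y) \<partial>lborel)"
        unfolding ker by (rule nn_integral_cmult) measurable
      also have "(\<integral>\<^sup>+y. g y * gauss ((1 / \<rho> z) *\<^sub>R y) \<partial>lborel) =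
          ennreal (\<rho> z ^ DIM('a)) * (\<integral>\<^sup>+x. g (\<rho> z *\<^sub>R x) * gauss x \<partial>lborel)"
        using z nn_integral_lborel_affine[of "\<lambda>y. g y * gauss ((1 / \<rho> z) *\<^sub>R y)" "\<rho> z" 0] by simp
      finally have "(\<integral>\<^sup>+y. g y * ker (norm (B y)) z \<partial>lborel) = (\<integral>\<^sup>+x. g (\<rho> z *\<^sub>R x) * gauss x \<partial>lborel)"
        using z by (simp add: mult.assoc[symmetric] ennreal_mult'[symmetric])
      then show "(\<integral>\<^sup>+x. g (\<rho> z *\<^sub>R x) \<partial>gauss_measure) = (\<integral>\<^sup>+y. g y * ker (norm (B y)) z / gauss_mass \<partial>lborel)"
        by (simp add: nn_integral_gauss_measure nn_integral_divide)
    qed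
    also have "\<dots> = (\<integral>\<^sup>+y. \<integral>\<^sup>+z. g y * ker (norm (B y)) z / gauss_mass \<partial>coords I \<partial>lborel)"
      by (rule IL.Fubini'[symmetric]) measurable
    also have "\<dots> = (\<integral>\<^sup>+y. c * (g y * ennreal (1 / norm (B y) ^ m)) \<partial>lborel)"
    proof (rule nn_integral_cong_AE, rule AE_mp[OF AE_lborel_singleton[of 0] AE_I2], rule impI)
      fix y :: 'a assume "y \<noteq> 0"
      define s where "s = norm (B y)"
      have s: "0 < s" using norm_B_pos[OF \<open>y \<noteq> 0\<close>] by (simp add: s_def)
      \<comment> \<open>Replacing z by s z has Jacobian s^(card I), while the kernel scales by
        s^(-n), n being the dimension; together they give s^(-m). The point y = 0, where this
        substitution breaks down, was discarded as a null set.\<close>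
      have \<rho>_scale: "\<rho> (\<lambda>i\<in>I. s * z i) = s * \<rho> z" for z
        unfolding \<rho>_def using s by (simp add: power_mult_distrib sum_distrib_left[symmetric] real_sqrt_mult)
      have ker_scale: "ker s (\<lambda>i\<in>I. s * z i) = ennreal (1 / s ^ DIM('a)) * ker 1 z" for z
        unfolding ker_def \<rho>_scale using s by (simp add: ennreal_mult'[symmetric] power_mult_distrib)
      have "(\<integral>\<^sup>+z. ker s z \<partial>coords I) = ennreal (s ^ card I) * (\<integral>\<^sup>+z. ker s (\<lambda>i\<in>I. s * z i) \<partial>coords I)"
        using nn_integral_PiM_affine[OF \<open>finite I\<close>, of s "ker s" "\<lambda>_. 0"] s by simp
      also have "\<dots> = ennreal (s ^ card I * (1 / s ^ DIM('a))) * (\<integral>\<^sup>+z. ker 1 z \<partial>coords I)"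
        unfolding ker_scale using s
        by (subst nn_integral_cmult) (auto simp: mult.assoc[symmetric] ennreal_mult'[symmetric])
      also have "s ^ card I * (1 / s ^ DIM('a)) = 1 / s ^ m"
        using s unfolding assms(3)[symmetric] by (simp add: power_add)
      finally have "(\<integral>\<^sup>+z. ker s z \<partial>coords I) = ennreal (1 / s ^ m) * (\<integral>\<^sup>+z. ker 1 z \<partial>coords I)" .
      then show "(\<integral>\<^sup>+z. g y * ker (norm (B y)) z / gauss_mass \<partial>coords I) = c * (g y * ennreal (1 / norm (B y) ^ m))"
        unfolding c_def s_def[symmetric]
        by (simp add: nn_integral_divide nn_integral_cmult divide_ennreal_def mult_ac)
    qed
    also have "\<dots> = c * (\<integral>\<^sup>+y. g y * ennreal (1 / norm (B y) ^ m) \<partial>lborel)"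
      by (rule nn_integral_cmult) measurable
    finally show ?thesis .
  qed
  ultimately show ?thesis using that by blast
qed

text \<open>The extremal set of given volume is the multiple \<open>{y. norm (B y) \<le> t}\<close> of the ellipsoid, where
  equality holds.\<close>

lemma nn_integral_inverse_norm_le:
  assumes [measurable]: "K \<in> sets borel" and K: "emeasure lborel K = ennreal (body_vol * t ^ DIM('a))"
    and "0 < t" "1 \<le> m" "m < DIM('a)"
  shows "(\<integral>\<^sup>+y. indicator K y * ennreal (1 / norm (B y) ^ m) \<partial>lborel) \<le>
    ennreal (real DIM('a) / real (DIM('a) - m) * (body_vol * t ^ (DIM('a) - m)))"
proof -
  let ?n = "DIM('a)"
  let ?d = body_vol
  define M where "M = density lborel (indicator K :: 'a \<Rightarrow> ennreal)"
  have d: "0 < ?d" by (rule body_vol_pos)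
  have em: "emeasure M A = emeasure lborel (K \<inter> A)" if "A \<in> sets borel" for A
    using that unfolding M_def by (simp add: emeasure_density indicator_inter_arith[symmetric])
  have sets_M [measurable_cong]: "sets M = sets borel" by (simp add: M_def)
  interpret M: finite_measure M
  proof
    show "emeasure M (space M) \<noteq> \<infinity>"
      using em[of UNIV] K by (simp add: M_def)
  qed
  have le: "emeasure M {x \<in> space M. norm (B x) \<le> r} \<le> ennreal (?d * t ^ ?n)"
    "0 < r \<Longrightarrow> emeasure M {x \<in> space M. norm (B x) \<le> r} \<le> ennreal (?d * r ^ ?n)" for r
  proof -
    have *: "emeasure M {x \<in> space M. norm (B x) \<le> r} = emeasure lborel (K \<inter> {x. norm (B x) \<le> r})"
      by (subst em[symmetric]) (auto simp: M_def)
    show "emeasure M {x \<in> space M. norm (B x) \<le> r} \<le> ennreal (?d * t ^ ?n)"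
      unfolding * K[symmetric] by (rule emeasure_mono) auto
    show "emeasure M {x \<in> space M. norm (B x) \<le> r} \<le> ennreal (?d * r ^ ?n)" if "0 < r"
      unfolding * emeasure_body[OF that, symmetric] by (rule emeasure_mono) auto
  qed
  have pos: "AE x in M. 0 < norm (B x)"
  proof -
    have "AE x in lborel. x \<noteq> (0::'a)" by (rule AE_lborel_singleton)
    then have "AE x in lborel. x \<in> K \<longrightarrow> 0 < norm (B x)"
      by eventually_elim (rule impI, erule norm_B_pos)
    then show ?thesis unfolding M_def by (subst AE_density) auto
  qed
  have "(\<integral>\<^sup>+y. indicator K y * ennreal (1 / norm (B y) ^ m) \<partial>lborel) = (\<integral>\<^sup>+y. ennreal (1 / norm (B y) ^ m) \<partial>M)"
    unfolding M_def by (subst nn_integral_density) auto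
  also have "\<dots> = (\<integral>\<^sup>+r. ennreal (real m / r ^ (m + 1)) * emeasure M {x \<in> space M. norm (B x) \<le> r} * indicator {0<..} r \<partial>lborel)"
    using pos \<open>1 \<le> m\<close> by (intro M.nn_integral_inverse_power_layer_cake) auto
  \<comment> \<open>The sublevel set in K is bounded by the ellipsoid of radius r and also by K
    itself, that is by \<open>body_vol\<close> times r^n or t^n with n the dimension. The first
    bound is used up to r = t and the second beyond; the overlap at r = t is harmless for an upper
    bound.\<close>
  also have "\<dots> \<le> (\<integral>\<^sup>+r. ennreal (real m * ?d * r ^ (?n - m - 1)) * indicator {0..t} r +
      ennreal (?d * t ^ ?n) * (ennreal (real m / r ^ (m + 1)) * indicator {t..} r) \<partial>lborel)"
  proof (rule nn_integral_mono)
    fix r :: real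
    consider "r \<le> 0" | "0 < r" "r \<le> t" | "t < r" by linarith
    then show "ennreal (real m / r ^ (m + 1)) * emeasure M {x \<in> space M. norm (B x) \<le> r} * indicator {0<..} r \<le>
      ennreal (real m * ?d * r ^ (?n - m - 1)) * indicator {0..t} r +
      ennreal (?d * t ^ ?n) * (ennreal (real m / r ^ (m + 1)) * indicator {t..} r)"
    proof cases
      case 2
      have "ennreal (real m / r ^ (m + 1)) * emeasure M {x \<in> space M. norm (B x) \<le> r} \<le>
          ennreal (real m / r ^ (m + 1)) * ennreal (?d * r ^ ?n)"
        using le(2)[OF 2(1)] by (intro mult_left_mono) auto
      also have "\<dots> = ennreal (real m / r ^ (m + 1) * (?d * r ^ ?n))"
        using 2 d by (intro ennreal_mult[symmetric]) auto
      also have "real m / r ^ (m + 1) * (?d * r ^ ?n) = real m * ?d * r ^ (?n - m - 1)"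
      proof -
        have "r ^ ?n = r ^ (?n - m - 1) * r ^ (m + 1)"
          using \<open>m < ?n\<close> by (simp only: power_add[symmetric]) simp
        then show ?thesis using 2 by simp
      qed
      finally show ?thesis using 2 by (simp add: add_increasing2)
    next
      case 3
      have "ennreal (real m / r ^ (m + 1)) * emeasure M {x \<in> space M. norm (B x) \<le> r} \<le>
          ennreal (real m / r ^ (m + 1)) * ennreal (?d * t ^ ?n)"
        using le(1) by (intro mult_left_mono) auto
      then show ?thesis using 3 \<open>0 < t\<close> by (simp add: mult.commute)
    qed simp
  qed
  also have "\<dots> = (\<integral>\<^sup>+r. ennreal (real m * ?d * r ^ (?n - m - 1)) * indicator {0..t} r \<partial>lborel) +
      ennreal (?d * t ^ ?n) * (\<integral>\<^sup>+r. ennreal (real m / r ^ (m + 1)) * indicator {t..} r \<partial>lborel)"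
    by (subst nn_integral_add) (auto simp: nn_integral_cmult)
  also have "(\<integral>\<^sup>+r. ennreal (real m * ?d * r ^ (?n - m - 1)) * indicator {0..t} r \<partial>lborel) =
      ennreal (real m * ?d * t ^ (?n - m) / real (?n - m) - real m * ?d * 0 ^ (?n - m) / real (?n - m))"
  proof (rule nn_integral_FTC_Icc)
    show "((\<lambda>r. real m * ?d * r ^ (?n - m) / real (?n - m)) has_real_derivative real m * ?d * r ^ (?n - m - 1)) (at r)" for r
      using \<open>m < ?n\<close> by (auto intro!: derivative_eq_intros)
  qed (use d \<open>0 < t\<close> in auto)
  also have "(\<integral>\<^sup>+r. ennreal (real m / r ^ (m + 1)) * indicator {t..} r \<partial>lborel) = ennreal (1 / t ^ m)"
    by (rule nn_integral_inverse_power_tail[OF \<open>0 < t\<close> \<open>1 \<le> m\<close>])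
  also have "ennreal (?d * t ^ ?n) * ennreal (1 / t ^ m) = ennreal (?d * t ^ ?n * (1 / t ^ m))"
    using d \<open>0 < t\<close> by (intro ennreal_mult[symmetric]) auto
  also have "?d * t ^ ?n * (1 / t ^ m) = ?d * t ^ (?n - m)"
    using \<open>0 < t\<close> \<open>m < ?n\<close> by (simp add: power_diff)
  also have "ennreal (real m * ?d * t ^ (?n - m) / real (?n - m) - real m * ?d * 0 ^ (?n - m) / real (?n - m)) + ennreal (?d * t ^ (?n - m))
      = ennreal (real m * ?d * t ^ (?n - m) / real (?n - m) + ?d * t ^ (?n - m))"
  proof -
    have "0 \<le> real m * ?d * t ^ (?n - m) / real (?n - m)" "0 \<le> ?d * t ^ (?n - m)"
      using d \<open>0 < t\<close> by auto
    moreover have "(0::real) ^ (?n - m) = 0" using \<open>m < ?n\<close> by simp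
    ultimately show ?thesis by (simp only: mult_zero_right div_0 diff_0_right ennreal_plus)
  qed
  \<comment> \<open>The inner layers contribute m/(n-m) and the tail contributes 1, where n is the
    dimension: this is the origin of the factor n/(n-m).\<close>
  also have "real m * ?d * t ^ (?n - m) / real (?n - m) + ?d * t ^ (?n - m) = real ?n / real (?n - m) * (?d * t ^ (?n - m))"
    using \<open>m < ?n\<close> by (simp add: field_simps of_nat_diff)
  finally show ?thesis .
qed

end

text \<open>For a fixed frame, the integral over its coordinates is \<open>coord_ball_vol\<close>
  times a section integral, so S can be pulled out of the average. The constant of
  \<open>nn_integral_gauss_sections\<close> then occurs on both sides, and being positive and finite
  it cancels.\<close>

lemma nn_integral_inverse_norm_le_sections:
  fixes B :: "real ^ 'n \<Rightarrow> real ^ 'n"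
  assumes "linear B" "inj B" and [measurable]: "g \<in> borel_measurable borel"
    and "1 \<le> m" "m < CARD('n)"
    and S: "\<And>H. H \<in> Grassmannian (CARD('n) - m) \<Longrightarrow> (\<integral>\<^sup>+x. g x \<partial>subspace_lborel H) \<le> S"
  shows "ennreal (unit_ball_vol (real (CARD('n) - m))) * (\<integral>\<^sup>+y. g y * ennreal (1 / norm (B y) ^ m) \<partial>lborel) \<le>
    S * (\<integral>\<^sup>+y. indicator (cball 0 1) y * ennreal (1 / norm (B y) ^ m) \<partial>lborel)"
proof -
  interpret injective_linear B by (rule injective_linear.intro) fact+
  obtain I :: "'n set" where I: "card I = CARD('n) - m" "finite I"
    using obtain_subset_with_card_n[of "CARD('n) - m" "UNIV :: 'n set"] by auto
  then have "I \<noteq> {}" using \<open>m < CARD('n)\<close> by auto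
  obtain c where c: "0 < c" "c < \<infinity>" and c_eq: "\<And>g :: real ^ 'n \<Rightarrow> ennreal. g \<in> borel_measurable borel \<Longrightarrow>
      (\<integral>\<^sup>+G. \<integral>\<^sup>+z. g (lin_comb I G z) \<partial>coords I \<partial>Pi\<^sub>M I (\<lambda>_. gauss_measure)) =
      c * (\<integral>\<^sup>+y. g y * ennreal (1 / norm (B y) ^ m) \<partial>lborel)"
    by (rule nn_integral_gauss_sections[OF \<open>finite I\<close> \<open>I \<noteq> {}\<close>, of m]) (use I \<open>1 \<le> m\<close> \<open>m < CARD('n)\<close> in auto)
  interpret I: sigma_finite_measure "coords I"
    using \<open>finite I\<close> by (rule lborel_product.sigma_finite)
  note [measurable] = measurable_lin_comb_pair[of I]
  let ?P = "Pi\<^sub>M I (\<lambda>_. gauss_measure)"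
  let ?v = "ennreal (unit_ball_vol (real (CARD('n) - m)))"
  define J where "J = (\<integral>\<^sup>+y. indicator (cball 0 1) y * ennreal (1 / norm (B y) ^ m) \<partial>lborel)"
  have [measurable]: "(\<lambda>G. coord_ball_vol I G) \<in> borel_measurable ?P"
    unfolding coord_ball_vol_def by measurable
  have V: "(\<integral>\<^sup>+G. coord_ball_vol I G \<partial>?P) = c * J"
    unfolding J_def coord_ball_vol_def by (rule c_eq) measurable
  have "J < \<infinity>"
  proof -
    \<comment> \<open>The radius at which the ellipsoid has the volume of the unit ball, so that
      \<open>nn_integral_inverse_norm_le\<close> applies to the latter.\<close>
    define t where "t = root CARD('n) (unit_ball_vol (real CARD('n)) / body_vol)"
    have "0 < t" unfolding t_def using body_vol_pos by simp
    moreover have "body_vol * t ^ CARD('n) = unit_ball_vol (real CARD('n))"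
      unfolding t_def using body_vol_pos by simp
    ultimately have "J \<le> ennreal (real DIM(real ^ 'n) / real (DIM(real ^ 'n) - m) * (body_vol * t ^ (DIM(real ^ 'n) - m)))"
      unfolding J_def using \<open>1 \<le> m\<close> \<open>m < CARD('n)\<close>
      by (intro nn_integral_inverse_norm_le) (auto simp: emeasure_cball)
    then show ?thesis by (simp add: le_less_trans)
  qed
  then have "(\<integral>\<^sup>+G. coord_ball_vol I G \<partial>?P) \<noteq> \<infinity>"
    unfolding V using c by (auto simp: ennreal_mult_eq_top_iff)
  \<comment> \<open>A finite mean makes \<open>coord_ball_vol\<close> finite almost everywhere, and
    finiteness forces independence. Hence almost every Gaussian frame spans a subspace of the right
    dimension, with no separate argument on degenerate frames.\<close>
  then have "AE G in ?P. coord_ball_vol I G \<noteq> \<infinity>"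
    by (intro nn_integral_PInf_AE) measurable
  then have *: "AE G in ?P. ?v * (\<integral>\<^sup>+z. g (lin_comb I G z) \<partial>coords I) \<le> coord_ball_vol I G * S"
  proof eventually_elim
    fix G :: "'n \<Rightarrow> real ^ 'n" assume "coord_ball_vol I G \<noteq> \<infinity>"
    then have fin: "coord_ball_vol I G < \<infinity>" by (simp add: less_top)
    have "span (G ` I) \<in> Grassmannian (CARD('n) - m)"
      using coord_ball_vol_finite_imp_dim[OF \<open>finite I\<close> fin] I by (simp add: Grassmannian_def)
    then show "?v * (\<integral>\<^sup>+z. g (lin_comb I G z) \<partial>coords I) \<le> coord_ball_vol I G * S"
      using nn_integral_subspace_lborel[OF \<open>finite I\<close> fin, of g] S I by (auto intro: mult_left_mono)
  qed
  have "c * (?v * (\<integral>\<^sup>+y. g y * ennreal (1 / norm (B y) ^ m) \<partial>lborel)) =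
      (\<integral>\<^sup>+G. ?v * (\<integral>\<^sup>+z. g (lin_comb I G z) \<partial>coords I) \<partial>?P)"
    by (subst nn_integral_cmult) (auto simp: c_eq mult_ac)
  also have "\<dots> \<le> (\<integral>\<^sup>+G. coord_ball_vol I G * S \<partial>?P)"
    by (rule nn_integral_mono_AE[OF *])
  also have "\<dots> = c * (S * J)"
    by (subst nn_integral_multc) (auto simp: V mult_ac)
  finally show ?thesis
    using c unfolding J_def by (simp add: ennreal_mult_le_mult_iff)
qed

section \<open>Existence of a maximal section\<close>

lemma sets_subspace_lborel [simp, measurable_cong]: "sets (subspace_lborel H) = sets borel"
  by (simp add: subspace_lborel_def Let_def)

lemma AE_subspace_lborel:
  assumes "subspace H"
  shows "AE x in subspace_lborel H. x \<in> H"
proof -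
  define B where "B = (SOME B. orthonormal_basis_of H B)"
  have B: "orthonormal_basis_of H B"
    unfolding B_def by (rule someI_ex) (rule orthonormal_basis_of_exists[OF assms])
  then have "(\<Sum>b\<in>B. c b *\<^sub>R b) \<in> H" for c
    using lin_comb_in_span[of B "\<lambda>b. b" c] by (simp add: lin_comb_def orthonormal_basis_of_def)
  then show ?thesis
    unfolding subspace_lborel_def Let_def B_def[symmetric]
    by (subst AE_distr_iff) (auto simp: closed_subspace[OF assms])
qed

text \<open>The vectors of a frame are rows of a square matrix, so that frames of any size live in
  one Euclidean space; rows outside \<open>I\<close> are set to zero, without which the set would
  not be bounded.\<close>

definition orthonormal_frames :: "'n set \<Rightarrow> (real ^ 'n ^ 'n) set" where
  "orthonormal_frames I = {W. (\<forall>i\<in>I. norm (W $ i) = 1) \<and>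
     (\<forall>i\<in>I. \<forall>j\<in>I. i \<noteq> j \<longrightarrow> W $ i \<bullet> W $ j = 0) \<and> (\<forall>i\<in>-I. W $ i = 0)}"

lemma compact_orthonormal_frames: "compact (orthonormal_frames (I :: 'n::finite set))"
  unfolding compact_eq_bounded_closed
proof
  have "norm W \<le> real CARD('n)" if "W \<in> orthonormal_frames I" for W :: "real ^ 'n ^ 'n"
  proof -
    have "norm (W $ i) \<le> 1" for i using that by (cases "i \<in> I") (auto simp: orthonormal_frames_def)
    then have "(\<Sum>i\<in>UNIV. norm (W $ i)) \<le> (\<Sum>i\<in>(UNIV::'n set). 1)" by (intro sum_mono)
    moreover have "norm W \<le> (\<Sum>i\<in>UNIV. norm (W $ i))"
      unfolding norm_vec_def by (intro L2_set_le_sum) auto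
    ultimately show ?thesis by simp
  qed
  then show "bounded (orthonormal_frames I)" by (auto simp: bounded_iff)
  show "closed (orthonormal_frames I)"
  proof -
    have "orthonormal_frames I = (\<Inter>i\<in>I. {W. norm (W $ i) = 1}) \<inter>
        (\<Inter>i\<in>I. \<Inter>j\<in>I - {i}. {W. W $ i \<bullet> W $ j = 0}) \<inter> (\<Inter>i\<in>-I. {W. W $ i = 0})"
      by (auto simp: orthonormal_frames_def)
    also have "closed \<dots>"
      by (intro closed_Int closed_INT ballI closed_Collect_eq continuous_intros)
    finally show ?thesis .
  qed
qed

text \<open>For an orthonormal frame \<open>coord_ball_vol\<close> equals
  \<open>unit_ball_vol\<close>, and the factors cancel. All section integrals thereby become
  integrals over one fixed coordinate space, with the frame only in the integrand, which is what
  passing to limits requires.\<close>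

lemma nn_integral_frame:
  assumes W: "W \<in> orthonormal_frames I" and [measurable]: "g \<in> borel_measurable borel"
  shows "(\<integral>\<^sup>+x. g x \<partial>subspace_lborel (span (($) W ` I))) = (\<integral>\<^sup>+z. g (lin_comb I (($) W) z) \<partial>coords I)"
    and "dim (span (($) W ` I)) = card I"
proof -
  have v: "coord_ball_vol I (($) W) = ennreal (unit_ball_vol (card I))"
    using W by (intro coord_ball_vol_orthonormal) (auto simp: orthonormal_frames_def pairwise_def orthogonal_def)
  then have fin: "coord_ball_vol I (($) W) < \<infinity>" by simp
  show "dim (span (($) W ` I)) = card I"
    using coord_ball_vol_finite_imp_dim[OF _ fin] by simp
  show "(\<integral>\<^sup>+x. g x \<partial>subspace_lborel (span (($) W ` I))) = (\<integral>\<^sup>+z. g (lin_comb I (($) W) z) \<partial>coords I)"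
  proof -
    have "unit_ball_vol (real (card I)) \<noteq> 0" by (metis less_irrefl of_nat_0_le_iff unit_ball_vol_pos)
    then show ?thesis
      using nn_integral_subspace_lborel[OF _ fin, of g] unfolding v
      by (auto simp: ennreal_mult_cancel_left)
  qed
qed

lemma Grassmannian_frame:
  assumes "H \<in> Grassmannian (card I)"
  obtains W where "W \<in> orthonormal_frames I" "span (($) W ` I) = H"
proof -
  have "subspace H" "dim H = card I" using assms by (auto simp: Grassmannian_def)
  then obtain B where B: "orthonormal_basis_of H B" using orthonormal_basis_of_exists by blast
  then have "finite B" "card B = card I"
    using orthonormal_basis_card[OF B] \<open>dim H = card I\<close> by auto
  then obtain b where b: "bij_betw b I B"
    using finite_same_card_bij[of I B] by auto
  define W where "W = (\<chi> i. if i \<in> I then b i else 0)"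
  have img: "($) W ` I = B" using b by (auto simp: W_def bij_betw_def)
  have "W \<in> orthonormal_frames I"
    using B b by (auto simp: orthonormal_frames_def W_def orthonormal_basis_of_def pairwise_def orthogonal_def bij_betw_def inj_on_def)
  with img B that show ?thesis by (auto simp: orthonormal_basis_of_def)
qed

text \<open>A maximizing sequence of frames has a convergent subsequence. The integrand jumps at the
  boundary of L, but L is closed, so the limit can only gain mass: section integrals are upper
  semicontinuous in the frame.\<close>

lemma section_integral_attains_max:
  fixes L :: "(real ^ 'n) set" and f :: "real ^ 'n \<Rightarrow> real"
  assumes "compact L" "continuous_on UNIV f" "k \<le> CARD('n)"
  defines "g \<equiv> \<lambda>x. ennreal (f x) * indicator L x"
  shows "\<exists>H \<in> Grassmannian k. (\<integral>\<^sup>+x. g x \<partial>subspace_lborel H) < \<infinity> \<and>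
    (\<forall>K \<in> Grassmannian k. (\<integral>\<^sup>+x. g x \<partial>subspace_lborel K) \<le> (\<integral>\<^sup>+x. g x \<partial>subspace_lborel H))"
proof -
  obtain I :: "'n set" where I: "card I = k"
    using obtain_subset_with_card_n[of k "UNIV :: 'n set"] assms(3) by auto
  have [measurable]: "f \<in> borel_measurable borel" "L \<in> sets borel"
    using assms(1,2) by (auto intro: borel_measurable_continuous_onI borel_compact)
  have [measurable]: "g \<in> borel_measurable borel" unfolding g_def by measurable
  define F where "F W z = g (lin_comb I (($) W) z)" for W z
  have [measurable]: "F W \<in> borel_measurable (coords I)" for W
    unfolding F_def by measurable
  define \<Phi> where "\<Phi> W = (\<integral>\<^sup>+z. F W z \<partial>coords I)" for W
  let ?Fr = "orthonormal_frames I"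
  obtain R where R: "0 < R" "\<And>x. x \<in> L \<Longrightarrow> norm x \<le> R"
    using compact_imp_bounded[OF \<open>compact L\<close>] unfolding bounded_pos by blast
  have "compact (f ` L)"
    using assms(1,2) by (intro compact_continuous_image) (auto intro: continuous_on_subset)
  then obtain M where M: "\<And>x. x \<in> L \<Longrightarrow> f x \<le> M"
    using compact_imp_bounded bounded_imp_bdd_above by (metis bdd_above.unfold image_eqI)
  have norm: "norm (lin_comb I (($) W) z) = sqrt (\<Sum>i\<in>I. (z i)\<^sup>2)" if "W \<in> ?Fr" for W z
    using that by (intro norm_lin_comb_orthonormal) (auto simp: orthonormal_frames_def pairwise_def orthogonal_def)
  have usc: "limsup (\<lambda>n. g (x n)) \<le> g y" if "x \<longlonglongrightarrow> y" for x y
  proof (cases "y \<in> L")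
    case True
    have "isCont f y" using assms(2) by (simp add: continuous_on_eq_continuous_at)
    then have "(\<lambda>n. ennreal (f (x n))) \<longlonglongrightarrow> ennreal (f y)"
      using that by (rule tendsto_ennrealI[OF isCont_tendsto_compose])
    then have "limsup (\<lambda>n. ennreal (f (x n))) = ennreal (f y)"
      by (intro lim_imp_Limsup) auto
    moreover have "limsup (\<lambda>n. g (x n)) \<le> limsup (\<lambda>n. ennreal (f (x n)))"
      by (intro Limsup_mono always_eventually) (auto simp: g_def indicator_def)
    ultimately show ?thesis using True by (simp add: g_def)
  next
    case False
    have "open (- L)" using \<open>compact L\<close> by (simp add: compact_imp_closed open_Compl)
    then have "\<forall>\<^sub>F n in sequentially. x n \<in> - L" using that False by (auto dest: topological_tendstoD)
    then have "\<forall>\<^sub>F n in sequentially. g (x n) \<le> 0" by eventually_elim (simp add: g_def)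
    then have "limsup (\<lambda>n. g (x n)) \<le> 0" by (rule Limsup_bounded)
    then show ?thesis by simp
  qed
  have "?Fr \<noteq> {}"
  proof -
    have "(\<chi> i. if i \<in> I then axis i 1 else 0) \<in> ?Fr"
      by (auto simp: orthonormal_frames_def inner_axis_axis)
    then show ?thesis by blast
  qed
  then obtain W0 where W0: "W0 \<in> ?Fr" by blast
  \<comment> \<open>All orthonormal frames give a combination the same norm, that of its coefficient
    vector. One fixed frame \<open>W0\<close> therefore describes a dominating function valid for
    all of them.\<close>
  define w where "w z = ennreal M * indicator (cball 0 R) (lin_comb I (($) W0) z)" for z
  have [measurable]: "w \<in> borel_measurable (coords I)" unfolding w_def by measurable
  have w_fin: "(\<integral>\<^sup>+z. w z \<partial>coords I) < \<infinity>"
  proof -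
    have "coord_ball_vol I (($) W0) = ennreal (unit_ball_vol (card I))"
      using W0 by (intro coord_ball_vol_orthonormal) (auto simp: orthonormal_frames_def pairwise_def orthogonal_def)
    then show ?thesis
      unfolding w_def using R(1)
      by (simp add: nn_integral_cmult nn_integral_lin_comb_cball ennreal_mult_less_top)
  qed
  have dom: "F W z \<le> w z" if "W \<in> ?Fr" for W z
  proof -
    have "lin_comb I (($) W) z \<in> L \<Longrightarrow> lin_comb I (($) W0) z \<in> cball 0 R"
      using R(2)[of "lin_comb I (($) W) z"] norm[OF that, of z] norm[OF W0, of z] by simp
    then show ?thesis
      using M by (auto simp: F_def g_def w_def indicator_def intro!: ennreal_leI)
  qed
  obtain u where u: "incseq u" "range u \<subseteq> \<Phi> ` ?Fr" "Sup (\<Phi> ` ?Fr) = (SUP n. u n)"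
    using ennreal_Sup_countable_SUP[of "\<Phi> ` ?Fr"] W0 by auto
  then have "\<forall>n. \<exists>W\<in>?Fr. u n = \<Phi> W" by (metis image_iff range_subsetD)
  then obtain W where W: "\<And>n. W n \<in> ?Fr" "\<And>n. u n = \<Phi> (W n)" by metis
  obtain W' r where W': "W' \<in> ?Fr" "strict_mono r" "(W \<circ> r) \<longlonglongrightarrow> W'"
    using compact_orthonormal_frames[of I] W(1) unfolding compact_def by metis
  have "u \<longlonglongrightarrow> Sup (\<Phi> ` ?Fr)"
    unfolding u(3) by (rule LIMSEQ_SUP[OF u(1)])
  then have "(u \<circ> r) \<longlonglongrightarrow> Sup (\<Phi> ` ?Fr)"
    using W'(2) by (rule LIMSEQ_subseq_LIMSEQ)
  then have "Sup (\<Phi> ` ?Fr) = limsup (u \<circ> r)"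
    using lim_imp_Limsup trivial_limit_sequentially by metis
  also have "\<dots> = limsup (\<lambda>n. \<integral>\<^sup>+z. F (W (r n)) z \<partial>coords I)"
    by (simp add: comp_def W(2) \<Phi>_def)
  \<comment> \<open>The reverse Fatou lemma, for which the integrable bound \<open>w\<close> is
    needed.\<close>
  also have "\<dots> \<le> (\<integral>\<^sup>+z. limsup (\<lambda>n. F (W (r n)) z) \<partial>coords I)"
    using dom W(1) w_fin by (intro nn_integral_limsup[where w = w]) auto
  also have "\<dots> \<le> (\<integral>\<^sup>+z. F W' z \<partial>coords I)"
  proof (rule nn_integral_mono)
    fix z
    have "(\<lambda>n. lin_comb I (($) (W (r n))) z) \<longlonglongrightarrow> lin_comb I (($) W') z"
      unfolding lin_comb_def using W'(3)
      by (intro tendsto_sum tendsto_scaleR tendsto_const tendsto_vec_nth) (simp add: comp_def)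
    then show "limsup (\<lambda>n. F (W (r n)) z) \<le> F W' z"
      unfolding F_def by (rule usc)
  qed
  finally have max: "Sup (\<Phi> ` ?Fr) \<le> \<Phi> W'" by (simp add: \<Phi>_def)
  define H where "H = span (($) W' ` I)"
  have \<Phi>: "(\<integral>\<^sup>+x. g x \<partial>subspace_lborel (span (($) V ` I))) = \<Phi> V" if "V \<in> ?Fr" for V
    unfolding \<Phi>_def F_def by (rule nn_integral_frame[OF that]) measurable
  show ?thesis
  proof (intro bexI conjI ballI)
    show "H \<in> Grassmannian k"
      using nn_integral_frame(2)[OF W'(1), of g] I by (simp add: H_def Grassmannian_def)
    have "\<Phi> W' \<le> (\<integral>\<^sup>+z. w z \<partial>coords I)"
      unfolding \<Phi>_def using dom[OF W'(1)] by (intro nn_integral_mono)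
    then show "(\<integral>\<^sup>+x. g x \<partial>subspace_lborel H) < \<infinity>"
      using w_fin by (simp add: H_def \<Phi>[OF W'(1)] le_less_trans)
  next
    fix K :: "(real ^ 'n) set" assume "K \<in> Grassmannian k"
    then obtain V where V: "V \<in> ?Fr" "span (($) V ` I) = K"
      using Grassmannian_frame[of K I] I by metis
    then have "(\<integral>\<^sup>+x. g x \<partial>subspace_lborel K) = \<Phi> V" using \<Phi> by blast
    also have "\<dots> \<le> Sup (\<Phi> ` ?Fr)" using V(1) by (intro Sup_upper) auto
    finally show "(\<integral>\<^sup>+x. g x \<partial>subspace_lborel K) \<le> (\<integral>\<^sup>+x. g x \<partial>subspace_lborel H)"
      using max \<Phi>[OF W'(1)] by (simp add: H_def order_trans)
  qed
qed

text \<open>A Bochner integral defaults to 0 when the integrand is not integrable, so agreement with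
  the nonnegative integral needs the latter to be finite.\<close>

lemma mu_section_eq_nn_integral:
  assumes "subspace H" "compact L" "continuous_on UNIV f" "\<And>x. 0 \<le> f x"
    and fin: "(\<integral>\<^sup>+x. ennreal (f x) * indicator L x \<partial>subspace_lborel H) < \<infinity>"
  shows "ennreal (mu_section f L H) = (\<integral>\<^sup>+x. ennreal (f x) * indicator L x \<partial>subspace_lborel H)"
proof -
  have [measurable]: "f \<in> borel_measurable borel" "L \<in> sets borel" "H \<in> sets borel"
    using assms by (auto intro: borel_measurable_continuous_onI borel_compact simp: closed_subspace)
  have "mu_section f L H = enn2real (\<integral>\<^sup>+x. ennreal (indicator (L \<inter> H) x *\<^sub>R f x) \<partial>subspace_lborel H)"
    unfolding mu_section_def set_lebesgue_integral_def using assms(4)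
    by (intro integral_eq_nn_integral) (auto intro!: AE_I2)
  also have "(\<integral>\<^sup>+x. ennreal (indicator (L \<inter> H) x *\<^sub>R f x) \<partial>subspace_lborel H) =
      (\<integral>\<^sup>+x. ennreal (f x) * indicator L x \<partial>subspace_lborel H)"
    by (rule nn_integral_cong_AE, use AE_subspace_lborel[OF assms(1)] in eventually_elim) (simp add: indicator_def)
  finally show ?thesis using fin by (simp add: less_top)
qed

lemma mu_eq_nn_integral:
  assumes "compact L" "continuous_on UNIV f" "\<And>x. 0 \<le> f x"
  shows "ennreal (mu f L) = (\<integral>\<^sup>+x. ennreal (f x) * indicator L x \<partial>lborel)"
proof -
  have [measurable]: "f \<in> borel_measurable borel" "L \<in> sets borel"
    using assms by (auto intro: borel_measurable_continuous_onI borel_compact)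
  have "set_integrable lborel L f"
    unfolding set_integrable_def
    using assms(1,2) by (intro borel_integrable_compact) (auto intro: continuous_on_subset)
  then have "ennreal (mu f L) = (\<integral>\<^sup>+x. ennreal (indicator L x *\<^sub>R f x) \<partial>lborel)"
    unfolding mu_def set_lebesgue_integral_def set_integrable_def using assms(3)
    by (intro nn_integral_eq_integral[symmetric]) (auto intro!: AE_I2)
  also have "\<dots> = (\<integral>\<^sup>+x. ennreal (f x) * indicator L x \<partial>lborel)"
    by (intro nn_integral_cong) (simp add: indicator_def)
  finally show ?thesis .
qed

section \<open>Lewis' position\<close>

lemma norm_matrix_vector_mult_le:
  fixes A :: "real ^ 'n ^ 'n"
  shows "norm (A *v x) \<le> real CARD('n) * norm A * norm x"
proof -
  have "norm (A *v x) \<le> (\<Sum>i\<in>UNIV. \<bar>(A *v x) $ i\<bar>)" by (rule norm_le_l1_cart)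
  also have "\<dots> \<le> (\<Sum>i\<in>(UNIV::'n set). norm A * norm x)"
  proof (rule sum_mono)
    fix i
    have "\<bar>(A *v x) $ i\<bar> = \<bar>A $ i \<bullet> x\<bar>" by (simp add: matrix_vector_mul_component)
    also have "\<dots> \<le> norm (A $ i) * norm x" by (rule Cauchy_Schwarz_ineq2)
    also have "\<dots> \<le> norm A * norm x" by (intro mult_right_mono component_le_norm_cart Finite_Cartesian_Product.norm_nth_le) auto
    finally show "\<bar>(A *v x) $ i\<bar> \<le> norm A * norm x" .
  qed
  finally show ?thesis by simp
qed

lemma norm_powr_le_sum:
  fixes x :: "real ^ 'n"
  assumes "0 \<le> p"
  shows "norm x powr p \<le> real CARD('n) powr p * (\<Sum>i\<in>UNIV. \<bar>x $ i\<bar> powr p)"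
proof -
  obtain j where j: "\<And>i. \<bar>x $ i\<bar> \<le> \<bar>x $ j\<bar>"
    using Max_in[of "range (\<lambda>i. \<bar>x $ i\<bar>)"] Max_ge[of "range (\<lambda>i. \<bar>x $ i\<bar>)"] by fastforce
  have "norm x \<le> (\<Sum>i\<in>UNIV. \<bar>x $ i\<bar>)" by (rule norm_le_l1_cart)
  also have "\<dots> \<le> (\<Sum>i\<in>(UNIV::'n set). \<bar>x $ j\<bar>)" by (intro sum_mono j)
  finally have "norm x \<le> real CARD('n) * \<bar>x $ j\<bar>" by simp
  then have "norm x powr p \<le> (real CARD('n) * \<bar>x $ j\<bar>) powr p"
    using assms by (intro powr_mono2) auto
  also have "\<dots> = real CARD('n) powr p * \<bar>x $ j\<bar> powr p" by (simp add: powr_mult)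
  also have "\<dots> \<le> real CARD('n) powr p * (\<Sum>i\<in>UNIV. \<bar>x $ i\<bar> powr p)"
    by (intro mult_left_mono member_le_sum) auto
  finally show ?thesis .
qed

text \<open>The quotient \<open>h\<close> of a power of the determinant by the integral is
  homogeneous of degree 0, so a maximum on the compact unit sphere is global. Competitors are
  written as products U A, so that later steps see only the transformed function A F, for which the
  identity is optimal.\<close>

lemma scaled_det_maximizer:
  fixes F :: "'b \<Rightarrow> real ^ 'n"
  assumes "0 < p" and [measurable]: "F \<in> borel_measurable M"
    and int: "integrable M (\<lambda>t. norm (F t) powr p)"
    and pos: "\<And>x. x \<noteq> 0 \<Longrightarrow> 0 < (\<integral>t. \<bar>x \<bullet> F t\<bar> powr p \<partial>M)"
  obtains A :: "real ^ 'n ^ 'n" where "det A \<noteq> 0"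
    "\<And>U. \<bar>det U\<bar> powr (p / CARD('n)) * (\<integral>t. norm (A *v F t) powr p \<partial>M) \<le> (\<integral>t. norm (U *v (A *v F t)) powr p \<partial>M)"
    "0 < (\<integral>t. norm (A *v F t) powr p \<partial>M)"
proof -
  define n where "n = real CARD('n)"
  have n: "0 < n" by (simp add: n_def)
  have [measurable]: "(\<lambda>t. A *v F t) \<in> borel_measurable M" for A :: "real ^ 'n ^ 'n"
    by (intro borel_measurable_continuous_on[OF _ assms(2)] linear_continuous_on) (simp add: linear_linear)
  define \<phi> where "\<phi> A = (\<integral>t. norm (A *v F t) powr p \<partial>M)" for A :: "real ^ 'n ^ 'n"
  have le: "norm (A *v F t) powr p \<le> (n * norm A) powr p * norm (F t) powr p" for A :: "real ^ 'n ^ 'n" and t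
  proof -
    have "norm (A *v F t) powr p \<le> (n * norm A * norm (F t)) powr p"
      unfolding n_def using \<open>0 < p\<close> by (intro powr_mono2 norm_matrix_vector_mult_le) auto
    then show ?thesis by (simp add: powr_mult)
  qed
  have int_A: "integrable M (\<lambda>t. norm (A *v F t) powr p)" for A :: "real ^ 'n ^ 'n"
  proof (rule Bochner_Integration.integrable_bound)
    show "integrable M (\<lambda>t. (n * norm A) powr p * norm (F t) powr p)" using int by simp
  qed (use le in \<open>auto intro!: AE_I2\<close>)
  \<comment> \<open>A single nonzero row suffices, so positivity covers singular matrices too;
    \<open>h\<close> is then continuous on the whole sphere.\<close>
  have \<phi>_pos: "0 < \<phi> A" if "A \<noteq> 0" for A
  proof -
    obtain i where i: "A $ i \<noteq> 0" using \<open>A \<noteq> 0\<close> by (metis vec_eq_iff zero_index)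
    have "\<bar>A $ i \<bullet> F t\<bar> \<le> norm (A *v F t)" for t
      using component_le_norm_cart[of "A *v F t" i] by (simp add: matrix_vector_mul_component)
    then have dom: "\<bar>A $ i \<bullet> F t\<bar> powr p \<le> norm (A *v F t) powr p" for t
      using \<open>0 < p\<close> by (intro powr_mono2) auto
    have "0 < (\<integral>t. \<bar>A $ i \<bullet> F t\<bar> powr p \<partial>M)" by (rule pos[OF i])
    also have "\<dots> \<le> \<phi> A"
      unfolding \<phi>_def using dom int_A by (intro integral_mono_AE' AE_I2) auto
    finally show ?thesis .
  qed
  have \<phi>_cont: "continuous_on (sphere 0 1) \<phi>"
  proof (rule continuous_on_sequentiallyI)
    fix u :: "nat \<Rightarrow> real ^ 'n ^ 'n" and A
    assume u: "\<forall>k. u k \<in> sphere 0 1" and lim: "u \<longlonglongrightarrow> A"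
    show "(\<lambda>k. \<phi> (u k)) \<longlonglongrightarrow> \<phi> A"
      unfolding \<phi>_def
    proof (rule integral_dominated_convergence[where w = "\<lambda>t. n powr p * norm (F t) powr p"])
      show "integrable M (\<lambda>t. n powr p * norm (F t) powr p)" using int by simp
      have "norm (u k) = 1" for k using u by simp
      then show "AE t in M. norm (norm (u k *v F t) powr p) \<le> n powr p * norm (F t) powr p" for k
        using le[of "u k"] by (intro AE_I2) simp
      show "AE t in M. (\<lambda>k. norm (u k *v F t) powr p) \<longlonglongrightarrow> norm (A *v F t) powr p"
      proof (rule AE_I2)
        fix t
        have "(\<lambda>k. u k *v F t) \<longlonglongrightarrow> A *v F t"
          unfolding matrix_vector_mult_def
          by (intro tendsto_vec_lambda tendsto_sum tendsto_mult tendsto_const tendsto_vec_nth lim)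
        then show "(\<lambda>k. norm (u k *v F t) powr p) \<longlonglongrightarrow> norm (A *v F t) powr p"
          using \<open>0 < p\<close> by (intro tendsto_powr' tendsto_norm tendsto_const) auto
      qed
    qed auto
  qed
  define h where "h A = \<bar>det A\<bar> powr (p / n) / \<phi> A" for A :: "real ^ 'n ^ 'n"
  have "continuous_on (sphere 0 1) h"
    unfolding h_def
  proof (intro continuous_on_divide \<phi>_cont continuous_on_powr' continuous_on_rabs continuous_on_const ballI)
    show "continuous_on (sphere 0 1) (det :: real ^ 'n ^ 'n \<Rightarrow> real)"
      unfolding det_def by (intro continuous_intros)
    show "\<phi> A \<noteq> 0" if "A \<in> sphere 0 1" for A
      using \<phi>_pos[of A] that by force
  qed (use \<open>0 < p\<close> n in auto)
  moreover have "sphere 0 1 \<noteq> ({} :: (real ^ 'n ^ 'n) set)" by simp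
  ultimately obtain A where A: "A \<in> sphere 0 1" and max: "\<And>C. C \<in> sphere 0 1 \<Longrightarrow> h C \<le> h A"
    using continuous_attains_sup[OF compact_sphere] by metis
  have scale: "h (c *\<^sub>R C) = h C" if "0 < c" for c C
  proof -
    have "det (c *\<^sub>R C) = c ^ CARD('n) * det C"
      by (simp add: det_def sum_distrib_left prod.distrib mult_ac)
    then have "\<bar>det (c *\<^sub>R C)\<bar> powr (p / n) = (c ^ CARD('n)) powr (p / n) * \<bar>det C\<bar> powr (p / n)"
      using that by (simp add: abs_mult powr_mult)
    also have "(c ^ CARD('n)) powr (p / n) = c powr p"
      using that by (simp add: n_def powr_realpow[symmetric] powr_powr)
    finally have "\<bar>det (c *\<^sub>R C)\<bar> powr (p / n) = c powr p * \<bar>det C\<bar> powr (p / n)" .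
    moreover have "\<phi> (c *\<^sub>R C) = c powr p * \<phi> C"
    proof -
      have "(c *\<^sub>R C) *v F t = c *\<^sub>R (C *v F t)" for t by (rule scaleR_matrix_vector_assoc[symmetric])
      then show ?thesis using that by (simp add: \<phi>_def powr_mult)
    qed
    ultimately show ?thesis using that by (simp add: h_def)
  qed
  have max': "h C \<le> h A" if "C \<noteq> 0" for C
  proof -
    have "h C = h ((1 / norm C) *\<^sub>R C)" using that by (subst scale) auto
    also have "\<dots> \<le> h A" using that by (intro max) auto
    finally show ?thesis .
  qed
  have "A \<noteq> 0" using A by auto
  have "0 < h (mat 1)"
  proof -
    have "(mat 1 :: real ^ 'n ^ 'n) \<noteq> 0" by (simp add: vec_eq_iff mat_def)
    then show ?thesis using \<phi>_pos[of "mat 1"] by (simp add: h_def)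
  qed
  also have "\<dots> \<le> h A" by (intro max') (simp add: vec_eq_iff mat_def)
  finally have "det A \<noteq> 0" by (auto simp: h_def)
  moreover have "\<bar>det U\<bar> powr (p / n) * \<phi> A \<le> (\<integral>t. norm (U *v (A *v F t)) powr p \<partial>M)" for U
  \<comment> \<open>The maximum was taken over nonzero matrices. If the product vanishes, then det U
    = 0 and the left side is zero.\<close>
  proof (cases "U ** A = 0")
    case True
    have "det U * det A = det (U ** A)" by (simp add: det_mul)
    also have "\<dots> = 0" unfolding True by (simp add: det_def zero_power)
    finally have "det U = 0" using \<open>det A \<noteq> 0\<close> by simp
    then show ?thesis by (simp add: integral_nonneg_AE)
  next
    case False
    then have "h (U ** A) \<le> h A" by (rule max')
    then have "\<bar>det U\<bar> powr (p / n) * \<phi> A * \<bar>det A\<bar> powr (p / n) \<le> \<phi> (U ** A) * \<bar>det A\<bar> powr (p / n)"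
      using \<phi>_pos[OF \<open>A \<noteq> 0\<close>] \<phi>_pos[OF False]
      by (simp add: h_def det_mul abs_mult powr_mult field_simps)
    moreover have "0 < \<bar>det A\<bar> powr (p / n)" using \<open>det A \<noteq> 0\<close> by simp
    ultimately have "\<bar>det U\<bar> powr (p / n) * \<phi> A \<le> \<phi> (U ** A)" by (simp only: mult_le_cancel_right_pos)
    then show ?thesis by (simp add: \<phi>_def matrix_vector_mul_assoc)
  qed
  ultimately show ?thesis
    using that[of A] \<phi>_pos[OF \<open>A \<noteq> 0\<close>] by (simp add: \<phi>_def n_def)
qed

text \<open>A first-order expansion uniform in v, with error relative to |v|^p: by homogeneity it
  reduces to expanding (1 + u)^(p/2) at 0. The uniformity allows differentiation under the integral
  sign.\<close>

lemma norm_powr_shear_expansion: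
  fixes p \<epsilon> :: real
  assumes "0 < p" "0 < \<epsilon>"
  obtains \<delta> where "0 < \<delta>" "\<And>s (v :: real ^ 'n) i j. \<bar>s\<bar> < \<delta> \<Longrightarrow>
    \<bar>norm (v + (s * v $ j) *\<^sub>R axis i 1) powr p - norm v powr p - p * s * (norm v powr (p - 2) * (v $ i * v $ j))\<bar>
      \<le> \<epsilon> * \<bar>s\<bar> * norm v powr p"
proof -
  have "((\<lambda>u. (1 + u) powr (p / 2)) has_real_derivative p / 2) (at 0)"
    by (auto intro!: derivative_eq_intros)
  then have D: "\<forall>e>0. \<exists>d>0. \<forall>u. norm (u - 0) < d \<longrightarrow>
      norm ((1 + u) powr (p / 2) - (1 + 0) powr (p / 2) - p / 2 * (u - 0)) \<le> e * norm (u - 0)"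
    unfolding has_field_derivative_def has_derivative_at_alt by blast
  \<comment> \<open>Since |u| is at most 3|s|, the share \<epsilon>/6 becomes half of the allowed
    error; the other half goes to the quadratic term in s hidden in u.\<close>
  have "\<exists>d>0. \<forall>u. norm (u - 0) < d \<longrightarrow>
      norm ((1 + u) powr (p / 2) - (1 + 0) powr (p / 2) - p / 2 * (u - 0)) \<le> \<epsilon> / 6 * norm (u - 0)"
    using D[THEN spec, of "\<epsilon> / 6"] \<open>0 < \<epsilon>\<close> by simp
  then obtain \<delta>1 where \<delta>1: "0 < \<delta>1"
      "\<And>u. \<bar>u\<bar> < \<delta>1 \<Longrightarrow> \<bar>(1 + u) powr (p / 2) - 1 - p / 2 * u\<bar> \<le> \<epsilon> / 6 * \<bar>u\<bar>"
    unfolding diff_0_right real_norm_def by auto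
  \<comment> \<open>The three bounds ensure, in order, that s^2 is at most |s|, that |u| stays below
    \<open>\<delta>1\<close>, and that the quadratic term costs at most \<epsilon>|s|/2.\<close>
  define \<delta> where "\<delta> = min 1 (min (\<delta>1 / 3) (\<epsilon> / p))"
  have "0 < \<delta>" using assms \<delta>1(1) by (simp add: \<delta>_def)
  moreover have "\<bar>norm (v + (s * v $ j) *\<^sub>R axis i 1) powr p - norm v powr p - p * s * (norm v powr (p - 2) * (v $ i * v $ j))\<bar>
      \<le> \<epsilon> * \<bar>s\<bar> * norm v powr p" if s: "\<bar>s\<bar> < \<delta>" for s i j and v :: "real ^ 'n"
  proof (cases "v = 0")
    case False
    define a where "a = (norm v)\<^sup>2"
    have a: "0 < a" using False by (simp add: a_def)
    \<comment> \<open>The relative change of the squared norm under the shear.\<close>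
    define u where "u = (2 * s * (v $ i * v $ j) + s\<^sup>2 * (v $ j)\<^sup>2) / a"
    have sq: "(norm (v + (s * v $ j) *\<^sub>R axis i 1))\<^sup>2 = a * (1 + u)"
    proof -
      have "(norm (v + (s * v $ j) *\<^sub>R axis i 1))\<^sup>2 = a + (2 * s * (v $ i * v $ j) + s\<^sup>2 * (v $ j)\<^sup>2)"
        unfolding a_def power2_norm_eq_inner
        by (simp add: inner_add_left inner_add_right inner_axis inner_commute[of "axis i 1"] power2_eq_square algebra_simps)
      then show ?thesis using a by (simp add: u_def field_simps)
    qed
    then have "0 \<le> a * (1 + u)" by (metis zero_le_power2)
    then have u0: "0 \<le> 1 + u" using a by (simp add: zero_le_mult_iff)
    have vij: "\<bar>v $ k * v $ l\<bar> \<le> a" for k l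
      unfolding a_def abs_mult power2_eq_square by (intro mult_mono component_le_norm_cart) auto
    have s1: "\<bar>s\<bar> < 1" "\<bar>s\<bar> < \<delta>1 / 3" "\<bar>s\<bar> < \<epsilon> / p" using s by (auto simp: \<delta>_def)
    have s2: "s\<^sup>2 \<le> \<bar>s\<bar>"
      using s1(1) mult_left_le[of "\<bar>s\<bar>" "\<bar>s\<bar>"] by (simp add: power2_eq_square)
    have u3: "\<bar>u\<bar> \<le> 3 * \<bar>s\<bar>"
    proof -
      have "\<bar>2 * s * (v $ i * v $ j) + s\<^sup>2 * (v $ j)\<^sup>2\<bar> \<le> \<bar>2 * s * (v $ i * v $ j)\<bar> + \<bar>s\<^sup>2 * (v $ j)\<^sup>2\<bar>"
        by (rule abs_triangle_ineq)
      also have "\<bar>2 * s * (v $ i * v $ j)\<bar> \<le> 2 * \<bar>s\<bar> * a"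
        unfolding abs_mult[of "2 * s"] using vij[of i j] by (intro mult_mono) auto
      also have "\<bar>s\<^sup>2 * (v $ j)\<^sup>2\<bar> \<le> \<bar>s\<bar> * a"
        unfolding abs_mult[of "s\<^sup>2"] using vij[of j j] s2 by (intro mult_mono) (auto simp: power2_eq_square)
      finally show ?thesis using a by (simp add: u_def field_simps)
    qed
    have "norm (v + (s * v $ j) *\<^sub>R axis i 1) powr p = ((norm (v + (s * v $ j) *\<^sub>R axis i 1))\<^sup>2) powr (p / 2)"
      by (simp add: powr_powr powr_realpow'[symmetric] flip: powr_numeral)
    also have "\<dots> = a powr (p / 2) * (1 + u) powr (p / 2)"
      unfolding sq using a u0 by (simp add: powr_mult)
    finally have e1: "norm (v + (s * v $ j) *\<^sub>R axis i 1) powr p = a powr (p / 2) * (1 + u) powr (p / 2)" .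
    have e2: "norm v powr p = a powr (p / 2)"
      using False by (simp add: a_def powr_powr flip: powr_numeral)
    have e3: "norm v powr (p - 2) = a powr (p / 2) / a"
      using False unfolding e2[symmetric] by (simp add: a_def powr_diff)
    have split: "p * s * (v $ i * v $ j) / a = p / 2 * u - p / 2 * (s\<^sup>2 * ((v $ j)\<^sup>2 / a))"
      using a by (simp add: u_def field_simps)
    have "norm (v + (s * v $ j) *\<^sub>R axis i 1) powr p - norm v powr p - p * s * (norm v powr (p - 2) * (v $ i * v $ j)) =
        a powr (p / 2) * ((1 + u) powr (p / 2) - 1 - p * s * (v $ i * v $ j) / a)"
      unfolding e1 e2 e3 by (simp add: algebra_simps)
    also have "\<bar>\<dots>\<bar> = a powr (p / 2) * \<bar>(1 + u) powr (p / 2) - 1 - p * s * (v $ i * v $ j) / a\<bar>"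
      by (simp add: abs_mult)
    also have "\<dots> \<le> a powr (p / 2) * (\<epsilon> * \<bar>s\<bar>)"
    proof (rule mult_left_mono)
      have "\<bar>(1 + u) powr (p / 2) - 1 - p / 2 * u\<bar> \<le> \<epsilon> / 6 * \<bar>u\<bar>"
        using u3 s1(2) by (intro \<delta>1(2)) linarith
      also have "\<dots> \<le> \<epsilon> / 6 * (3 * \<bar>s\<bar>)" using u3 \<open>0 < \<epsilon>\<close> by (intro mult_left_mono) auto
      finally have t1: "\<bar>(1 + u) powr (p / 2) - 1 - p / 2 * u\<bar> \<le> \<epsilon> / 2 * \<bar>s\<bar>" by simp
      have "(v $ j)\<^sup>2 / a \<le> 1" using vij[of j j] a by (simp add: power2_eq_square)
      then have "p / 2 * (s\<^sup>2 * ((v $ j)\<^sup>2 / a)) \<le> p / 2 * (s\<^sup>2 * 1)"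
        using \<open>0 < p\<close> by (intro mult_left_mono) auto
      also have "\<dots> = (p * \<bar>s\<bar>) / 2 * \<bar>s\<bar>" by (simp add: power2_eq_square)
      also have "\<dots> \<le> \<epsilon> / 2 * \<bar>s\<bar>"
        using s1(3) \<open>0 < p\<close> by (intro mult_right_mono) (auto simp: field_simps)
      finally have t2: "p / 2 * (s\<^sup>2 * ((v $ j)\<^sup>2 / a)) \<le> \<epsilon> / 2 * \<bar>s\<bar>" .
      have t3: "0 \<le> p / 2 * (s\<^sup>2 * ((v $ j)\<^sup>2 / a))" using \<open>0 < p\<close> a by simp
      show "\<bar>(1 + u) powr (p / 2) - 1 - p * s * (v $ i * v $ j) / a\<bar> \<le> \<epsilon> * \<bar>s\<bar>"
        unfolding split using t1 t2 t3 by linarith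
    qed simp
    finally show ?thesis unfolding e2 by (simp add: mult_ac)
  qed simp
  ultimately show ?thesis using that by blast
qed

text \<open>Perturbing the optimal identity by elementary matrices gives a function of s minimal at
  0. A diagonal perturbation changes the determinant to first order and an off-diagonal one does
  not, whence the Kronecker delta; the diagonal value fits the fact that the diagonal moments sum to
  the full integral.\<close>

lemma second_moments_of_maximizer:
  fixes G :: "'b \<Rightarrow> real ^ 'n"
  assumes "0 < p" and [measurable]: "G \<in> borel_measurable M"
    and int: "integrable M (\<lambda>t. norm (G t) powr p)"
    and max: "\<And>U. \<bar>det U\<bar> powr (p / CARD('n)) * (\<integral>t. norm (G t) powr p \<partial>M) \<le> (\<integral>t. norm (U *v G t) powr p \<partial>M)"
  shows "integrable M (\<lambda>t. norm (G t) powr (p - 2) * (G t $ i * G t $ j))"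
    and "(\<integral>t. norm (G t) powr (p - 2) * (G t $ i * G t $ j) \<partial>M) =
      (if i = j then (\<integral>t. norm (G t) powr p \<partial>M) / CARD('n) else 0)"
proof -
  define n where "n = real CARD('n)"
  have n: "0 < n" by (simp add: n_def)
  have [measurable]: "(\<lambda>t. G t $ k) \<in> borel_measurable M" for k
    by (rule borel_measurable_continuous_on[of "\<lambda>v. v $ k", OF _ assms(2)]) (intro continuous_intros)
  define \<phi> where "\<phi> = (\<integral>t. norm (G t) powr p \<partial>M)"
  define b where "b = (\<integral>t. norm (G t) powr (p - 2) * (G t $ i * G t $ j) \<partial>M)"
  show int_b: "integrable M (\<lambda>t. norm (G t) powr (p - 2) * (G t $ i * G t $ j))"
  proof (rule Bochner_Integration.integrable_bound[OF int])
    show "AE t in M. norm (norm (G t) powr (p - 2) * (G t $ i * G t $ j)) \<le> norm (norm (G t) powr p)"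
    proof (rule AE_I2)
      fix t
      have "\<bar>G t $ i * G t $ j\<bar> \<le> norm (G t) * norm (G t)"
        unfolding abs_mult by (intro mult_mono component_le_norm_cart) auto
      then have "norm (G t) powr (p - 2) * \<bar>G t $ i * G t $ j\<bar> \<le> norm (G t) powr (p - 2) * (norm (G t) * norm (G t))"
        by (intro mult_left_mono) auto
      also have "\<dots> = norm (G t) powr p"
        by (cases "G t = 0") (auto simp: powr_diff power2_eq_square)
      finally show "norm (norm (G t) powr (p - 2) * (G t $ i * G t $ j)) \<le> norm (norm (G t) powr p)"
        by (simp add: abs_mult)
    qed
  qed measurable
  \<comment> \<open>The elementary matrix 1 + s E_ij. These directions span all matrices, so they
    capture the full first-order condition.\<close>
  define U :: "real \<Rightarrow> real ^ 'n ^ 'n" where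
    "U s = (\<chi> k. if k = i then row i (mat 1) + s *s row j (mat 1) else row k (mat 1))" for s
  have U: "U s *v v = v + (s * v $ j) *\<^sub>R axis i 1" for s v
  proof -
    have row: "row k (mat 1 :: real ^ 'n ^ 'n) = axis k 1" for k
      by (auto simp: vec_eq_iff row_def mat_def axis_def)
    show ?thesis
      unfolding vec_eq_iff matrix_vector_mul_component U_def row
      by (simp add: inner_add_left inner_axis' scalar_mult_eq_scaleR) (simp add: axis_def)
  qed
  have detU: "det (U s) = (if i = j then 1 + s else 1)" for s
  proof (cases "i = j")
    case True
    have "U s = (\<chi> k. if k = i then (1 + s) *s row k (mat 1) else row k (mat 1))"
      using True by (auto simp: U_def vec_eq_iff algebra_simps)
    then have "det (U s) = (1 + s) * det ((\<chi> k. if k = i then row k (mat 1) else row k (mat 1)) :: real ^ 'n ^ 'n)"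
      by (simp only: det_row_mul)
    also have "((\<chi> k. if k = i then row k (mat 1) else row k (mat 1)) :: real ^ 'n ^ 'n) = mat 1"
      by (simp add: vec_eq_iff row_def)
    finally show ?thesis using True by simp
  next
    case False
    then show ?thesis unfolding U_def by (subst det_row_operation) auto
  qed
  define \<psi> where "\<psi> s = (\<integral>t. norm (G t + (s * G t $ j) *\<^sub>R axis i 1) powr p \<partial>M)" for s
  have int_\<psi>: "integrable M (\<lambda>t. norm (G t + (s * G t $ j) *\<^sub>R axis i 1) powr p)" for s
  proof (rule Bochner_Integration.integrable_bound)
    show "integrable M (\<lambda>t. (1 + \<bar>s\<bar>) powr p * norm (G t) powr p)" using int by simp
    show "AE t in M. norm (norm (G t + (s * G t $ j) *\<^sub>R axis i 1) powr p) \<le> norm ((1 + \<bar>s\<bar>) powr p * norm (G t) powr p)"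
    proof (rule AE_I2)
      fix t
      have "norm (G t + (s * G t $ j) *\<^sub>R axis i 1) \<le> norm (G t) + \<bar>s\<bar> * \<bar>G t $ j\<bar>"
        by (rule norm_triangle_le) (simp add: abs_mult)
      also have "\<dots> \<le> (1 + \<bar>s\<bar>) * norm (G t)"
        using mult_left_mono[OF component_le_norm_cart[of "G t" j], of "\<bar>s\<bar>"] by (simp add: algebra_simps)
      finally have "norm (G t + (s * G t $ j) *\<^sub>R axis i 1) powr p \<le> ((1 + \<bar>s\<bar>) * norm (G t)) powr p"
        using \<open>0 < p\<close> by (intro powr_mono2) auto
      then show "norm (norm (G t + (s * G t $ j) *\<^sub>R axis i 1) powr p) \<le> norm ((1 + \<bar>s\<bar>) powr p * norm (G t) powr p)"
        by (simp add: powr_mult)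
    qed
  qed measurable
  have \<phi>0: "0 \<le> \<phi>" unfolding \<phi>_def by (intro integral_nonneg_AE) auto
  have \<psi>0: "\<psi> 0 = \<phi>" by (simp add: \<psi>_def \<phi>_def)
  have deriv: "(\<psi> has_real_derivative p * b) (at 0)"
    unfolding has_field_derivative_def has_derivative_at_alt
  proof (intro conjI allI impI)
    show "bounded_linear ((*) (p * b))" by (rule bounded_linear_mult_right)
    fix e :: real assume "0 < e"
    \<comment> \<open>After integration the relative error is multiplied by \<phi>; dividing by 1 +
      \<phi> beforehand keeps the total below e|s|, also when \<phi> is 0.\<close>
    then have "0 < e / (1 + \<phi>)" using \<phi>0 by simp
    from norm_powr_shear_expansion[OF \<open>0 < p\<close> this] obtain \<delta> where \<delta>: "0 < \<delta>"
      and exp: "\<And>s (v :: real ^ 'n) i j. \<bar>s\<bar> < \<delta> \<Longrightarrow>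
        \<bar>norm (v + (s * v $ j) *\<^sub>R axis i 1) powr p - norm v powr p - p * s * (norm v powr (p - 2) * (v $ i * v $ j))\<bar>
        \<le> e / (1 + \<phi>) * \<bar>s\<bar> * norm v powr p" by metis
    have "\<bar>\<psi> s - \<psi> 0 - p * b * s\<bar> \<le> e * \<bar>s\<bar>" if s: "\<bar>s\<bar> < \<delta>" for s
    proof -
      have eq: "\<psi> s - \<psi> 0 - p * b * s = (\<integral>t. norm (G t + (s * G t $ j) *\<^sub>R axis i 1) powr p - norm (G t) powr p
          - p * s * (norm (G t) powr (p - 2) * (G t $ i * G t $ j)) \<partial>M)"
        unfolding \<psi>0 using int int_b int_\<psi> by (simp add: \<psi>_def \<phi>_def b_def)
      have "\<bar>\<psi> s - \<psi> 0 - p * b * s\<bar> \<le> (\<integral>t. e / (1 + \<phi>) * \<bar>s\<bar> * norm (G t) powr p \<partial>M)"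
        unfolding eq
      proof (rule order_trans[OF integral_abs_bound integral_mono])
        show "integrable M (\<lambda>t. \<bar>norm (G t + (s * G t $ j) *\<^sub>R axis i 1) powr p - norm (G t) powr p
            - p * s * (norm (G t) powr (p - 2) * (G t $ i * G t $ j))\<bar>)"
          using int int_b int_\<psi> by (intro integrable_abs Bochner_Integration.integrable_diff integrable_mult_right)
        show "integrable M (\<lambda>t. e / (1 + \<phi>) * \<bar>s\<bar> * norm (G t) powr p)"
          using int by (rule integrable_mult_right)
      qed (rule exp[OF s])
      also have "\<dots> = e / (1 + \<phi>) * \<bar>s\<bar> * \<phi>"
        unfolding \<phi>_def by (rule integral_mult_right_zero)
      also have "\<dots> = e * \<bar>s\<bar> * (\<phi> / (1 + \<phi>))" by simp
      also have "\<dots> \<le> e * \<bar>s\<bar> * 1" using \<phi>0 \<open>0 < e\<close> by (intro mult_left_mono) auto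
      finally show ?thesis by simp
    qed
    then show "\<exists>d>0. \<forall>y. norm (y - 0) < d \<longrightarrow> norm (\<psi> y - \<psi> 0 - p * b * (y - 0)) \<le> e * norm (y - 0)"
      using \<delta> by auto
  qed
  define \<kappa> where "\<kappa> s = (if i = j then \<bar>1 + s\<bar> powr (p / n) else 1)" for s :: real
  define \<kappa>' where "\<kappa>' = (if i = j then p / n else 0)"
  have \<kappa>: "(\<kappa> has_real_derivative \<kappa>') (at 0)"
  proof (cases "i = j")
    case True
    have "((\<lambda>s. (1 + s) powr (p / n)) has_real_derivative p / n) (at 0)"
      by (auto intro!: derivative_eq_intros)
    moreover have "\<forall>\<^sub>F s :: real in nhds 0. (1 + s) powr (p / n) = \<kappa> s"
    proof -
      have "\<forall>\<^sub>F s :: real in nhds 0. s \<in> {-1<..}" by (rule eventually_nhds_in_open) auto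
      then show ?thesis by eventually_elim (simp add: \<kappa>_def True)
    qed
    ultimately show ?thesis
      using True DERIV_cong_ev[of 0 0 "\<lambda>s. (1 + s) powr (p / n)" \<kappa> "p / n" "p / n"] by (simp add: \<kappa>'_def)
  next
    case False
    then have "\<kappa> = (\<lambda>_. 1)" by (simp add: \<kappa>_def fun_eq_iff)
    then show ?thesis using False by (simp add: \<kappa>'_def)
  qed
  have "((\<lambda>s. \<psi> s - \<kappa> s * \<phi>) has_real_derivative p * b - \<kappa>' * \<phi>) (at 0)"
    by (intro derivative_intros deriv DERIV_cmult_right \<kappa>)
  moreover have "\<psi> 0 - \<kappa> 0 * \<phi> \<le> \<psi> s - \<kappa> s * \<phi>" for s
  proof -
    have \<kappa>_det: "\<kappa> s = \<bar>det (U s)\<bar> powr (p / n)" by (simp add: \<kappa>_def detU)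
    have "\<kappa> s * \<phi> \<le> \<psi> s"
      using max[of "U s"] unfolding \<kappa>_det U \<phi>_def \<psi>_def n_def .
    moreover have "\<kappa> 0 = 1" by (simp add: \<kappa>_def)
    ultimately show ?thesis by (simp add: \<psi>0)
  qed
  ultimately have "p * b - \<kappa>' * \<phi> = 0"
    by (intro DERIV_local_min[of "\<lambda>s. \<psi> s - \<kappa> s * \<phi>" _ 0 1]) auto
  then have "b = (if i = j then \<phi> / n else 0)"
    using \<open>0 < p\<close> n by (cases "i = j") (simp_all add: \<kappa>'_def field_simps)
  then show "(\<integral>t. norm (G t) powr (p - 2) * (G t $ i * G t $ j) \<partial>M) =
      (if i = j then (\<integral>t. norm (G t) powr p \<partial>M) / CARD('n) else 0)"
    by (simp add: b_def \<phi>_def n_def)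
qed

text \<open>In the optimal position the weighted second moment of y is \<tau>|y|^2, which bounds
  \<beta> y from above by Cauchy-Schwarz and from below by Hoelder. Moving A across the inner
  product turns these bounds for \<open>G\<close> into bounds for \<open>F\<close>: B is a multiple
  of the inverse of the transpose of A.\<close>

lemma lewis_position:
  fixes F :: "'b \<Rightarrow> real ^ 'n"
  assumes "2 < p" and [measurable]: "F \<in> borel_measurable M"
    and int: "integrable M (\<lambda>t. norm (F t) powr p)"
    and pos: "\<And>x. x \<noteq> 0 \<Longrightarrow> 0 < (\<integral>t. \<bar>x \<bullet> F t\<bar> powr p \<partial>M)"
  obtains B :: "real ^ 'n \<Rightarrow> real ^ 'n" where "linear B" "inj B"
    "\<And>x. norm (B x) \<le> (\<integral>t. \<bar>x \<bullet> F t\<bar> powr p \<partial>M) powr (1 / p)"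
    "\<And>x. (\<integral>t. \<bar>x \<bullet> F t\<bar> powr p \<partial>M) powr (1 / p) \<le> real CARD('n) powr (1 / 2 - 1 / p) * norm (B x)"
proof -
  have "0 < p" using \<open>2 < p\<close> by simp
  obtain A :: "real ^ 'n ^ 'n" where A: "det A \<noteq> 0"
    and max: "\<And>U. \<bar>det U\<bar> powr (p / CARD('n)) * (\<integral>t. norm (A *v F t) powr p \<partial>M) \<le> (\<integral>t. norm (U *v (A *v F t)) powr p \<partial>M)"
    and \<phi>_pos: "0 < (\<integral>t. norm (A *v F t) powr p \<partial>M)"
    using scaled_det_maximizer[OF \<open>0 < p\<close> assms(2-4)] by metis
  define n where "n = real CARD('n)"
  have n: "0 < n" by (simp add: n_def)
  define G where "G t = A *v F t" for t
  have [measurable]: "G \<in> borel_measurable M"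
    unfolding G_def by (intro borel_measurable_continuous_on[OF _ assms(2)] linear_continuous_on) (simp add: linear_linear)
  \<comment> \<open>A non-integrable function would have integral 0 by default, so the positive
    value already proves integrability.\<close>
  have int_G: "integrable M (\<lambda>t. norm (G t) powr p)"
    using \<phi>_pos not_integrable_integral_eq unfolding G_def by fastforce
  define \<tau> where "\<tau> = (\<integral>t. norm (G t) powr p \<partial>M) / n"
  have \<tau>: "0 < \<tau>" using \<phi>_pos n by (simp add: \<tau>_def G_def)
  have \<phi>: "(\<integral>t. norm (G t) powr p \<partial>M) = n * \<tau>" using n by (simp add: \<tau>_def)
  note moments = second_moments_of_maximizer[OF \<open>0 < p\<close> \<open>G \<in> borel_measurable M\<close> int_G max[folded G_def]]
  define w where "w y t = norm (G t) powr (p - 2) * (y \<bullet> G t)\<^sup>2" for y t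
  have w_sum: "w y t = (\<Sum>i\<in>UNIV. \<Sum>j\<in>UNIV. (y $ i * y $ j) * (norm (G t) powr (p - 2) * (G t $ i * G t $ j)))" for y t
    unfolding w_def by (simp add: inner_vec_def power2_eq_square sum_product sum_distrib_left mult_ac)
  have int_w: "integrable M (w y)" for y
    unfolding w_sum using moments(1) by (intro Bochner_Integration.integrable_sum integrable_mult_right)
  have w: "(\<integral>t. w y t \<partial>M) = \<tau> * (norm y)\<^sup>2" for y
  proof -
    have "(\<integral>t. w y t \<partial>M) = (\<Sum>i\<in>UNIV. \<Sum>j\<in>UNIV. (y $ i * y $ j) * (if i = j then \<tau> else 0))"
    proof -
      have "(\<integral>t. norm (G t) powr (p - 2) * (G t $ i * G t $ j) \<partial>M) = (if i = j then \<tau> else 0)" for i j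
        using moments(2)[of i j] by (simp add: \<tau>_def n_def split: if_splits)
      then show ?thesis unfolding w_sum using moments(1) by simp
    qed
    also have "\<dots> = (\<Sum>i\<in>UNIV. (y $ i)\<^sup>2 * \<tau>)"
      by (simp add: if_distrib[of "(*) _"] power2_eq_square cong: if_cong)
    also have "\<dots> = \<tau> * (norm y)\<^sup>2"
      unfolding power2_norm_eq_inner inner_vec_def
      by (simp add: power2_eq_square sum_distrib_right[symmetric])
    finally show ?thesis .
  qed
  define \<beta> where "\<beta> y = (\<integral>t. \<bar>y \<bullet> G t\<bar> powr p \<partial>M)" for y
  have pw: "\<bar>y \<bullet> G t\<bar> powr p \<le> norm y powr (p - 2) * w y t" for y t
  proof (cases "y \<bullet> G t = 0")
    case False
    have "\<bar>y \<bullet> G t\<bar> powr p = \<bar>y \<bullet> G t\<bar> powr (p - 2) * (y \<bullet> G t)\<^sup>2"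
      using False by (simp add: powr_diff)
    also have "\<dots> \<le> (norm y * norm (G t)) powr (p - 2) * (y \<bullet> G t)\<^sup>2"
      using \<open>2 < p\<close> by (intro mult_right_mono powr_mono2 Cauchy_Schwarz_ineq2) auto
    finally show ?thesis by (simp add: w_def powr_mult mult_ac)
  qed (use \<open>2 < p\<close> in \<open>simp add: w_def\<close>)
  have int_\<beta>: "integrable M (\<lambda>t. \<bar>y \<bullet> G t\<bar> powr p)" for y
  proof (rule Bochner_Integration.integrable_bound)
    show "integrable M (\<lambda>t. norm y powr (p - 2) * w y t)" using int_w by simp
    show "AE t in M. norm (\<bar>y \<bullet> G t\<bar> powr p) \<le> norm (norm y powr (p - 2) * w y t)"
      using order_trans[OF pw abs_ge_self] by (intro AE_I2) simp
  qed measurable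
  have upper: "\<beta> y \<le> \<tau> * norm y powr p" for y
  proof -
    have "\<beta> y \<le> (\<integral>t. norm y powr (p - 2) * w y t \<partial>M)"
      unfolding \<beta>_def using int_\<beta> int_w pw by (intro integral_mono) auto
    also have "\<dots> = \<tau> * (norm y powr (p - 2) * (norm y)\<^sup>2)" by (simp add: w)
    also have "norm y powr (p - 2) * (norm y)\<^sup>2 = norm y powr p"
      by (cases "y = 0") (use \<open>2 < p\<close> in \<open>auto simp: powr_diff\<close>)
    finally show ?thesis .
  qed
  have AT: "x \<bullet> G t = (transpose A *v x) \<bullet> F t" for x t
    unfolding G_def by (simp add: dot_lmul_matrix[symmetric])
  have AT_inv: "invertible (transpose A)"
    using A by (simp add: invertible_det_nz)
  have \<beta>_pos: "0 < \<beta> y" if "y \<noteq> 0" for y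
  proof -
    have "transpose A *v y \<noteq> 0"
      using that AT_inv by (metis invertible_def matrix_left_invertible_ker)
    then show ?thesis unfolding \<beta>_def AT by (rule pos)
  qed
  text \<open>Hoelder's inequality with exponents \<open>p / (p - 2)\<close> and \<open>p / 2\<close>, obtained by integrating Young's inequality.\<close>
  have lower: "\<tau> * (norm y)\<^sup>2 \<le> (n * \<tau>) powr (1 - 2 / p) * \<beta> y powr (2 / p)" if "y \<noteq> 0" for y
  proof -
    define D where "D = (n * \<tau>) powr (1 - 2 / p) * \<beta> y powr (2 / p)"
    have D: "0 < D" using n \<tau> \<beta>_pos[OF that] by (simp add: D_def)
    have "w y t \<le> D * ((1 - 2 / p) * (norm (G t) powr p / (n * \<tau>)) + 2 / p * (\<bar>y \<bullet> G t\<bar> powr p / \<beta> y))" for t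
    proof (cases "y \<bullet> G t = 0")
      case True
      then show ?thesis
        using D \<open>2 < p\<close> n \<tau> \<beta>_pos[OF that] by (simp add: w_def)
    next
      case False
      then have "G t \<noteq> 0" by auto
      have "(norm (G t) powr p / (n * \<tau>)) powr (1 - 2 / p) * (\<bar>y \<bullet> G t\<bar> powr p / \<beta> y) powr (2 / p)
          \<le> (1 - 2 / p) * (norm (G t) powr p / (n * \<tau>)) + 2 / p * (\<bar>y \<bullet> G t\<bar> powr p / \<beta> y)"
        using \<open>2 < p\<close> n \<tau> \<beta>_pos[OF that] False \<open>G t \<noteq> 0\<close>
        by (intro Youngs_inequality_0) auto
      moreover have "(norm (G t) powr p / (n * \<tau>)) powr (1 - 2 / p) * (\<bar>y \<bullet> G t\<bar> powr p / \<beta> y) powr (2 / p) = w y t / D"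
      proof -
        have "p * (1 - 2 / p) = p - 2" "p * (2 / p) = 2" using \<open>0 < p\<close> by (simp_all add: field_simps)
        then have "(norm (G t) powr p) powr (1 - 2 / p) = norm (G t) powr (p - 2)"
          "(\<bar>y \<bullet> G t\<bar> powr p) powr (2 / p) = (y \<bullet> G t)\<^sup>2"
          using False by (simp_all add: powr_powr)
        then show ?thesis
          using n \<tau> \<beta>_pos[OF that] by (simp add: powr_divide w_def D_def)
      qed
      ultimately show ?thesis using D by (simp add: divide_le_eq mult.commute)
    qed
    then have "(\<integral>t. w y t \<partial>M) \<le> (\<integral>t. D * ((1 - 2 / p) * (norm (G t) powr p / (n * \<tau>)) + 2 / p * (\<bar>y \<bullet> G t\<bar> powr p / \<beta> y)) \<partial>M)"
      using int_w int_G int_\<beta> by (intro integral_mono) auto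
    also have "\<dots> = D * ((1 - 2 / p) * ((n * \<tau>) / (n * \<tau>)) + 2 / p * (\<beta> y / \<beta> y))"
      using int_G int_\<beta>[of y] by (simp add: \<phi> \<beta>_def)
    also have "\<dots> = D" using n \<tau> \<beta>_pos[OF that] by simp
    finally show ?thesis by (simp add: w D_def)
  qed
  obtain C where "transpose A ** C = mat 1"
    using AT_inv unfolding invertible_def by blast
  then have C: "transpose A *v (C *v x) = x" for x
    by (simp add: matrix_vector_mul_assoc)
  have \<beta>_C: "(\<integral>t. \<bar>x \<bullet> F t\<bar> powr p \<partial>M) = \<beta> (C *v x)" for x
    unfolding \<beta>_def AT C ..
  \<comment> \<open>Taking square roots in \<open>lower\<close> gives c |y| as a lower bound for
    \<beta> y powr (1/p). With this normalization the lower estimate has constant 1 and the whole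
    distortion n^(1/2 - 1/p) falls on the upper one.\<close>
  define c where "c = \<tau> powr (1 / p) * n powr - (1 / 2 - 1 / p)"
  have c: "0 < c" using n \<tau> by (simp add: c_def)
  define B where "B x = c *\<^sub>R (C *v x)" for x
  have "linear B"
    unfolding B_def by (intro linear_compose_scale_right) simp
  moreover have "inj B"
    unfolding B_def using c C by (intro injI) (metis scaleR_cancel_left less_irrefl)
  moreover have "norm (B x) \<le> \<beta> (C *v x) powr (1 / p)" for x
  proof (cases "C *v x = 0")
    case False
    define y where "y = C *v x"
    have y: "y \<noteq> 0" using False by (simp add: y_def)
    have "(c * norm y)\<^sup>2 = \<tau> powr (2 / p) * n powr - (1 - 2 / p) / \<tau> * (\<tau> * (norm y)\<^sup>2)"
    proof -
      have "c\<^sup>2 = \<tau> powr (2 / p) * n powr - (1 - 2 / p)"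
        unfolding c_def by (simp add: power2_eq_square powr_add[symmetric] mult_ac)
      then show ?thesis using \<tau> by (simp add: power_mult_distrib)
    qed
    also have "\<dots> \<le> \<tau> powr (2 / p) * n powr - (1 - 2 / p) / \<tau> * ((n * \<tau>) powr (1 - 2 / p) * \<beta> y powr (2 / p))"
      using lower[OF y] \<tau> by (intro mult_left_mono) auto
    also have "\<dots> = \<beta> y powr (2 / p)"
      using n \<tau> by (simp add: powr_mult powr_minus powr_diff field_simps)
    also have "\<dots> = (\<beta> y powr (1 / p))\<^sup>2"
      by (simp add: power2_eq_square powr_add[symmetric])
    finally have "c * norm y \<le> \<beta> y powr (1 / p)"
      by (rule power2_le_imp_le) simp
    then show ?thesis using c by (simp add: B_def y_def)
  qed (simp add: B_def)
  moreover have "\<beta> (C *v x) powr (1 / p) \<le> n powr (1 / 2 - 1 / p) * norm (B x)" for x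
  proof -
    have "0 \<le> \<beta> (C *v x)" unfolding \<beta>_def by (intro integral_nonneg_AE) auto
    then have "\<beta> (C *v x) powr (1 / p) \<le> (\<tau> * norm (C *v x) powr p) powr (1 / p)"
      using upper[of "C *v x"] \<open>0 < p\<close> by (intro powr_mono2) auto
    also have "\<dots> = \<tau> powr (1 / p) * norm (C *v x)"
      using \<open>0 < p\<close> \<tau> by (simp add: powr_mult powr_powr)
    also have "\<dots> = n powr (1 / 2 - 1 / p) * norm (B x)"
      using c n unfolding B_def c_def by (simp add: powr_minus field_simps)
    finally show ?thesis .
  qed
  ultimately show ?thesis
    using that[of B] unfolding \<beta>_C n_def by blast
qed

section \<open>The inequality\<close>

text \<open>The null set on which linearity of T fails may depend on the vectors. Representatives of
  the images of the basis vectors define F, and for each fixed x only finitely many null sets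
  intervene; that suffices, since x enters through integrals alone.\<close>

lemma embeds_isometrically_in_Lp01_coordinates:
  fixes N :: "real ^ 'n \<Rightarrow> real"
  assumes "0 < p" "embeds_isometrically_in_Lp01 p N"
  obtains F :: "real \<Rightarrow> real ^ 'n" where "F \<in> borel_measurable (lebesgue_on {0..1})"
    "integrable (lebesgue_on {0..1}) (\<lambda>t. norm (F t) powr p)"
    "\<And>x. N x = (\<integral>t. \<bar>x \<bullet> F t\<bar> powr p \<partial>lebesgue_on {0..1}) powr (1 / p)"
proof -
  let ?M = "lebesgue_on {0..1::real}"
  obtain T :: "real ^ 'n \<Rightarrow> real \<Rightarrow> real" where
    Lp: "\<And>x. T x \<in> Lp_functions p ?M" and
    add: "\<And>x y. AE t in ?M. T (x + y) t = T x t + T y t" and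
    scale: "\<And>a x. AE t in ?M. T (a *\<^sub>R x) t = a * T x t" and
    norm: "\<And>x. Lp_norm p ?M (T x) = N x"
    using assms(2) unfolding embeds_isometrically_in_Lp01_def by blast
  have [measurable]: "T x \<in> borel_measurable ?M" and int: "integrable ?M (\<lambda>t. \<bar>T x t\<bar> powr p)" for x
    using Lp[of x] by (auto simp: Lp_functions_def)
  define F :: "real \<Rightarrow> real ^ 'n" where "F t = (\<Sum>i\<in>UNIV. T (axis i 1) t *\<^sub>R axis i 1)" for t
  have F_nth: "F t $ i = T (axis i 1) t" for t i
    by (simp add: F_def axis_def if_distrib cong: if_cong)
  have [measurable]: "F \<in> borel_measurable ?M" unfolding F_def by measurable
  have lin: "AE t in ?M. T (\<Sum>i\<in>J. x $ i *\<^sub>R axis i 1) t = (\<Sum>i\<in>J. x $ i * T (axis i 1) t)"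
    if "finite J" for J and x :: "real ^ 'n"
    using that
  proof (induction J rule: finite_induct)
    case empty
    show ?case using scale[of 0 0] by simp
  next
    case (insert i J)
    show ?case
      using insert.IH add[of "x $ i *\<^sub>R axis i 1" "\<Sum>i\<in>J. x $ i *\<^sub>R axis i 1"] scale[of "x $ i" "axis i 1"]
      by eventually_elim (use insert.hyps in simp)
  qed
  have T: "AE t in ?M. T x t = x \<bullet> F t" for x
    using lin[of UNIV x] basis_expansion[of x] by (simp add: scalar_mult_eq_scaleR inner_vec_def F_nth)
  show ?thesis
  proof
    show "F \<in> borel_measurable ?M" by measurable
    show "integrable ?M (\<lambda>t. norm (F t) powr p)"
    proof (rule Bochner_Integration.integrable_bound)
      show "integrable ?M (\<lambda>t. real CARD('n) powr p * (\<Sum>i\<in>UNIV. \<bar>F t $ i\<bar> powr p))"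
        unfolding F_nth using int by (intro integrable_mult_right Bochner_Integration.integrable_sum)
      show "AE t in ?M. norm (norm (F t) powr p) \<le> norm (real CARD('n) powr p * (\<Sum>i\<in>UNIV. \<bar>F t $ i\<bar> powr p))"
        using norm_powr_le_sum[of p] \<open>0 < p\<close> by (intro AE_I2) (simp add: abs_mult sum_nonneg)
    qed measurable
    show "N x = (\<integral>t. \<bar>x \<bullet> F t\<bar> powr p \<partial>?M) powr (1 / p)" for x
    proof -
      have "(\<integral>t. \<bar>T x t\<bar> powr p \<partial>?M) = (\<integral>t. \<bar>x \<bullet> F t\<bar> powr p \<partial>?M)"
        using T[of x] by (intro integral_cong_AE) auto
      then show ?thesis using norm[of x] by (simp add: Lp_norm_def)
    qed
  qed
qed

text \<open>The two norm bounds become the two inclusions. They also give compactness of L: the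
  lower bound makes it bounded, and the upper one makes N Lipschitz, hence L closed.\<close>

lemma Lp_ball_between_ellipsoids:
  fixes L :: "(real ^ 'n) set"
  assumes "2 < p" "unit_ball_of_subspace_of_Lp p L"
  obtains B :: "real ^ 'n \<Rightarrow> real ^ 'n" where "linear B" "inj B" "compact L"
    "\<And>x. x \<in> L \<Longrightarrow> norm (B x) \<le> 1"
    "\<And>x. norm (B x) \<le> real CARD('n) powr - (1 / 2 - 1 / p) \<Longrightarrow> x \<in> L"
proof -
  obtain N where N: "is_norm N" and emb: "embeds_isometrically_in_Lp01 p N" and L: "L = {x. N x \<le> 1}"
    using assms(2) unfolding unit_ball_of_subspace_of_Lp_def by blast
  have "0 < p" using \<open>2 < p\<close> by simp
  obtain F :: "real \<Rightarrow> real ^ 'n" where F: "F \<in> borel_measurable (lebesgue_on {0..1})"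
    "integrable (lebesgue_on {0..1}) (\<lambda>t. norm (F t) powr p)"
    and NF: "\<And>x. N x = (\<integral>t. \<bar>x \<bullet> F t\<bar> powr p \<partial>lebesgue_on {0..1}) powr (1 / p)"
    using embeds_isometrically_in_Lp01_coordinates[OF \<open>0 < p\<close> emb] by metis
  have "0 < (\<integral>t. \<bar>x \<bullet> F t\<bar> powr p \<partial>lebesgue_on {0..1})" if "x \<noteq> 0" for x
  proof -
    have "N x \<noteq> 0" using N that by (simp add: is_norm_def)
    moreover have "0 \<le> (\<integral>t. \<bar>x \<bullet> F t\<bar> powr p \<partial>lebesgue_on {0..1})" by (intro integral_nonneg_AE) auto
    ultimately show ?thesis unfolding NF by (simp add: less_le)
  qed
  from lewis_position[OF \<open>2 < p\<close> F this] obtain B :: "real ^ 'n \<Rightarrow> real ^ 'n" where B: "linear B" "inj B"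
    and le: "\<And>x. norm (B x) \<le> N x" and ge: "\<And>x. N x \<le> real CARD('n) powr (1 / 2 - 1 / p) * norm (B x)"
    unfolding NF[symmetric] by metis
  interpret injective_linear B by (rule injective_linear.intro) fact+
  have "compact L"
    unfolding compact_eq_bounded_closed
  proof
    show "bounded L"
      using bounded_body[of 1] by (rule bounded_subset) (use le in \<open>auto simp: L intro: order_trans\<close>)
    obtain K where K: "\<And>x. norm (B x) \<le> K * norm x" "0 < K" using linear_bounded_pos[OF B(1)] by blast
    define C where "C = real CARD('n) powr (1 / 2 - 1 / p) * K"
    have NC: "N x \<le> C * norm x" for x
    proof -
      have "N x \<le> real CARD('n) powr (1 / 2 - 1 / p) * (K * norm x)"
        using ge[of x] K(1)[of x] by (meson mult_left_mono order_trans powr_ge_zero)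
      then show ?thesis by (simp add: C_def)
    qed
    have diff: "N x - N y \<le> C * norm (x - y)" for x y
    proof -
      have "N ((x - y) + y) \<le> N (x - y) + N y" using N unfolding is_norm_def by blast
      then show ?thesis using NC[of "x - y"] by simp
    qed
    have "C-lipschitz_on UNIV N"
    proof (rule lipschitz_onI)
      show "dist (N x) (N y) \<le> C * dist x y" for x y
        using diff[of x y] diff[of y x] by (simp add: dist_norm norm_minus_commute abs_le_iff)
      show "0 \<le> C" using K(2) by (simp add: C_def)
    qed
    then have "continuous_on UNIV N" by (rule lipschitz_on_continuous_on)
    then show "closed L" unfolding L by (intro closed_Collect_le continuous_on_const)
  qed
  moreover have "norm (B x) \<le> 1" if "x \<in> L" for x
    using le[of x] that by (simp add: L)
  moreover have "x \<in> L" if "norm (B x) \<le> real CARD('n) powr - (1 / 2 - 1 / p)" for x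
  proof -
    have "N x \<le> real CARD('n) powr (1 / 2 - 1 / p) * real CARD('n) powr - (1 / 2 - 1 / p)"
      using ge[of x] that by (meson mult_left_mono order_trans powr_ge_zero)
    also have "\<dots> = 1" by (simp flip: powr_add)
    finally show ?thesis by (simp add: L)
  qed
  ultimately show ?thesis using that B by blast
qed

theorem theorem3:
  fixes p :: real and m :: nat and L :: "(real ^ 'n) set" and f :: "real ^ 'n \<Rightarrow> real"
  assumes "2 < p"
    and "1 \<le> m" and "m \<le> CARD('n) - 1"
    and "unit_ball_of_subspace_of_Lp p L"
    and "continuous_on UNIV f" and "\<And>x. f (- x) = f x" and "\<And>x. 0 \<le> f x"
  shows "\<exists>H \<in> Grassmannian (CARD('n) - m).
           (\<forall>K \<in> Grassmannian (CARD('n) - m). mu_section f L K \<le> mu_section f L H) \<and>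
           mu f L \<le> real CARD('n) powr (real m / 2 - real m / p)
                     * (real CARD('n) / (real CARD('n) - real m))
                     * c_const CARD('n) m
                     * mu_section f L H
                     * measure lborel L powr (real m / real CARD('n))"
proof -
  let ?k = "CARD('n) - m"
  define n where "n = real CARD('n)"
  have m: "m < CARD('n)" "real m < n" "0 < n" using assms(2,3) by (auto simp: n_def)
  define s where "s = 1 / 2 - 1 / p"
  obtain B :: "real ^ 'n \<Rightarrow> real ^ 'n" where B: "linear B" "inj B" and "compact L"
    and B_le: "\<And>x. x \<in> L \<Longrightarrow> norm (B x) \<le> 1"
    and B_ge: "\<And>x. norm (B x) \<le> n powr - s \<Longrightarrow> x \<in> L"
    using Lp_ball_between_ellipsoids[OF assms(1,4)] unfolding n_def s_def by metis
  interpret injective_linear B by (rule injective_linear.intro) fact+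
  let ?d = body_vol
  define v where "v = unit_ball_vol n"
  define vk where "vk = unit_ball_vol (real ?k)"
  have v: "0 < v" "0 < vk" using m by (auto simp: v_def vk_def)
  have d: "0 < ?d" by (rule body_vol_pos)
  have [measurable]: "f \<in> borel_measurable borel" "L \<in> sets borel"
    using assms(5) \<open>compact L\<close> by (auto intro: borel_measurable_continuous_onI borel_compact)
  define g where "g x = ennreal (f x) * indicator L x" for x
  have [measurable]: "g \<in> borel_measurable borel" unfolding g_def by measurable
  obtain H :: "(real ^ 'n) set" where H: "H \<in> Grassmannian ?k" "(\<integral>\<^sup>+x. g x \<partial>subspace_lborel H) < \<infinity>"
    and max: "\<And>K. K \<in> Grassmannian ?k \<Longrightarrow> (\<integral>\<^sup>+x. g x \<partial>subspace_lborel K) \<le> (\<integral>\<^sup>+x. g x \<partial>subspace_lborel H)"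
    using section_integral_attains_max[OF \<open>compact L\<close> assms(5), of ?k] unfolding g_def by auto
  \<comment> \<open>Finiteness of the maximal section integral passes to every other section, so all
    Bochner integrals can be compared as nonnegative integrals.\<close>
  have sec: "ennreal (mu_section f L K) = (\<integral>\<^sup>+x. g x \<partial>subspace_lborel K)" if "K \<in> Grassmannian ?k" for K
    using that max[OF that] H(2) assms(5,7) \<open>compact L\<close> unfolding g_def Grassmannian_def
    by (intro mu_section_eq_nn_integral) (auto intro: le_less_trans)
  have sec_nonneg: "0 \<le> mu_section f L K" for K
    unfolding mu_section_def set_lebesgue_integral_def using assms(7) by (intro integral_nonneg_AE AE_I2) auto
  \<comment> \<open>The ellipsoid of radius t has the volume v of the unit ball, which makes it the
    extremal set in \<open>nn_integral_inverse_norm_le\<close>.\<close>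
  define t where "t = (v / ?d) powr (1 / n)"
  have t: "0 < t" using v d by (simp add: t_def)
  have tn: "?d * t ^ CARD('n) = v"
    using v d m by (simp add: t_def n_def powr_powr flip: powr_realpow)
  \<comment> \<open>This separates the power of the ellipsoid volume, to be compared with the volume
    of L, from the power of v that forms the numerator of \<open>c_const\<close>.\<close>
  have tk: "?d * t ^ ?k = ?d powr (real m / n) * v powr ((n - real m) / n)"
  proof -
    have "t ^ ?k = (v / ?d) powr ((n - real m) / n)"
      using t m v d by (simp add: t_def n_def powr_powr of_nat_diff flip: powr_realpow)
    also have "\<dots> = v powr ((n - real m) / n) / ?d powr ((n - real m) / n)"
      using v d by (simp add: powr_divide)
    also have "?d powr ((n - real m) / n) = ?d / ?d powr (real m / n)"
      using d m by (simp add: diff_divide_distrib powr_diff)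
    finally show ?thesis using d by simp
  qed
  have vol: "?d * (n powr - s) ^ CARD('n) \<le> measure lborel L"
  proof -
    have "ennreal (?d * (n powr - s) ^ CARD('n)) = emeasure lborel {x. norm (B x) \<le> n powr - s}"
      using m by (subst emeasure_body) auto
    also have "\<dots> \<le> emeasure lborel L" using B_ge by (intro emeasure_mono) auto
    also have "\<dots> = ennreal (measure lborel L)"
      using emeasure_bounded_finite[OF compact_imp_bounded[OF \<open>compact L\<close>]] by (intro emeasure_eq_ennreal_measure) auto
    finally show ?thesis by (simp add: ennreal_le_iff)
  qed
  \<comment> \<open>L contains the ellipsoid of radius n^(-s), so its volume bounds
    \<open>body_vol\<close> at the cost of n^(s n). Raised to the power m/n, this cost is n^(m s),
    the dimensional factor of the theorem.\<close>
  have dm: "?d powr (real m / n) \<le> n powr (real m * s) * measure lborel L powr (real m / n)"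
  proof -
    have "(n powr - s) ^ CARD('n) = n powr (- s * n)"
      using m by (simp add: powr_powr n_def flip: powr_realpow)
    then have "?d \<le> measure lborel L * n powr (s * n)"
      using vol m by (simp add: powr_minus field_simps)
    then have "?d powr (real m / n) \<le> (measure lborel L * n powr (s * n)) powr (real m / n)"
      using d m by (intro powr_mono2) auto
    also have "\<dots> = measure lborel L powr (real m / n) * n powr (s * n * (real m / n))"
      by (simp add: powr_mult powr_powr)
    finally show ?thesis using m by (simp add: mult_ac)
  qed
  have "ennreal (mu f L) \<le> (\<integral>\<^sup>+y. g y * ennreal (1 / norm (B y) ^ m) \<partial>lborel)"
    unfolding mu_eq_nn_integral[OF \<open>compact L\<close> assms(5,7)] g_def[symmetric]
  proof (rule nn_integral_mono_AE)
    \<comment> \<open>At the origin the quotient 1 / 0 evaluates to 0 and the pointwise bound may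
      fail, so this null set is removed first.\<close>
    have "AE y in lborel. y \<noteq> (0 :: real ^ 'n)" by (rule AE_lborel_singleton)
    then show "AE y in lborel. g y \<le> g y * ennreal (1 / norm (B y) ^ m)"
    proof eventually_elim
      fix y :: "real ^ 'n" assume "y \<noteq> 0"
      show "g y \<le> g y * ennreal (1 / norm (B y) ^ m)"
      proof (cases "y \<in> L")
        case True
        have "1 \<le> 1 / norm (B y) ^ m"
          using norm_B_pos[OF \<open>y \<noteq> 0\<close>] B_le[OF True] by (simp add: power_le_one)
        then have "g y * ennreal 1 \<le> g y * ennreal (1 / norm (B y) ^ m)"
          by (intro mult_left_mono ennreal_leI) auto
        then show ?thesis by simp
      qed (simp add: g_def)
    qed
  qed
  then have "ennreal vk * ennreal (mu f L) \<le> ennreal vk * (\<integral>\<^sup>+y. g y * ennreal (1 / norm (B y) ^ m) \<partial>lborel)"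
    by (intro mult_left_mono) auto
  also have "\<dots> \<le> (\<integral>\<^sup>+x. g x \<partial>subspace_lborel H) * (\<integral>\<^sup>+y. indicator (cball 0 1) y * ennreal (1 / norm (B y) ^ m) \<partial>lborel)"
    unfolding vk_def using m assms(2) max by (intro nn_integral_inverse_norm_le_sections B) auto
  also have "\<dots> \<le> ennreal (mu_section f L H) * ennreal (n / (n - real m) * (?d * t ^ ?k))"
  proof -
    have "emeasure lborel (cball 0 1 :: (real ^ 'n) set) = ennreal (?d * t ^ DIM(real ^ 'n))"
      by (simp add: emeasure_cball tn v_def n_def)
    from nn_integral_inverse_norm_le[OF _ this t assms(2)] m
    have "(\<integral>\<^sup>+y. indicator (cball 0 1) y * ennreal (1 / norm (B y) ^ m) \<partial>lborel) \<le> ennreal (n / (n - real m) * (?d * t ^ ?k))"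
      by (simp add: n_def of_nat_diff)
    then show ?thesis unfolding sec[OF H(1), symmetric] by (rule mult_left_mono) simp
  qed
  finally have "ennreal (vk * mu f L) \<le> ennreal (mu_section f L H * (n / (n - real m) * (?d * t ^ ?k)))"
    using v sec_nonneg[of H] by (simp only: ennreal_mult' less_imp_le)
  then have "vk * mu f L \<le> mu_section f L H * (n / (n - real m) * (?d * t ^ ?k))"
    using d t m sec_nonneg[of H] by (subst (asm) ennreal_le_iff) auto
  also have "\<dots> \<le> mu_section f L H * (n / (n - real m) *
      (n powr (real m * s) * measure lborel L powr (real m / n) * v powr ((n - real m) / n)))"
    unfolding tk using dm m sec_nonneg by (intro mult_left_mono mult_right_mono) auto
  finally have "mu f L * vk \<le> mu_section f L H * (n / (n - real m) *
      (n powr (real m * s) * measure lborel L powr (real m / n) * v powr ((n - real m) / n)))"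
    by (simp only: mult.commute[of "mu f L"])
  then have "mu f L \<le> mu_section f L H * (n / (n - real m) *
      (n powr (real m * s) * measure lborel L powr (real m / n) * v powr ((n - real m) / n))) / vk"
    by (rule mult_imp_le_div_pos[OF v(2)])
  then have "mu f L \<le> n powr (real m * s) * (n / (n - real m)) * (v powr ((n - real m) / n) / vk) *
      mu_section f L H * measure lborel L powr (real m / n)"
    by (simp add: mult_ac)
  moreover have "real m * s = real m / 2 - real m / p" by (simp add: s_def algebra_simps)
  moreover have "mu_section f L K \<le> mu_section f L H" if "K \<in> Grassmannian ?k" for K
    using max[OF that] sec_nonneg unfolding sec[OF that, symmetric] sec[OF H(1), symmetric]
    by (simp add: ennreal_le_iff)
  ultimately show ?thesis
    using H(1) by (intro bexI[of _ H]) (auto simp: c_const_def v_def vk_def n_def)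
qed

end
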